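(* Let $G$ be a countable commutative semigroup and let $(m,\vec F,c)$ be a shape in $G$, with $\vec F=(F_1,\dots,F_m)$. Assume that at least one of the following holds: (1) The map $c$ is the identity map and, for each $j=1,\dots,m$, we have $F_j\subset\mathrm{Hom}(G^j,G)$. (2) $G$ is a group, the image of $c$ has finite index in $G$ and, for each $j=1,\dots,m$, $F_j\subset\mathbb{P}(G^j,G)$. Then $(m,\vec F,c)$ is partition regular: for every finite partition $G=C_1\cup\cdots\cup C_r$ there exist $i\in\{1,\dots,r\}$ and $\mathbf{s}\in(G\setminus\{0\})^{m+1}$ such that $D(m,\vec F,c;\mathbf{s})\subset C_i$.
   Context: $\mathbb{N}=\{1,2,\dots\}$. "Countable" means countably infinite. Semigroups are written additively; $0$ denotes the identity of $G$ if there is one, and $G\setminus\{0\}=G$ if $G$ has no identity. A shape in $G$ is a triple $(m,\vec F,c)$ where $m\in\mathbb{N}$, $c:G\to G$ is a homomorphism and $\vec F=(F_1,\dots,F_m)$ with each $F_j$ a finite set of functions $G^j\to G$. For $\mathbf{s}=(s_0,\dots,s_m)\in(G\setminus\{0\})^{m+1}$, $$D(m,\vec F,c;\mathbf{s})=\{c(s_0)\}\cup\bigcup_{j=1}^m\{f(s_0,\dots,s_{j-1})+c(s_j):f\in F_j\}.$$ $\mathrm{Hom}(H,G)$ is the set of semigroup homomorphisms $H\to G$. For abelian groups $H,G$, a map $f:H\to G$ is a polynomial map of degree $0$ if it is constant, and a polynomial map of degree $d\in\mathbb{N}$ if it is not a polynomial map of degree at most $d-1$ and for every $h\in H$ the map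 $x\mapsto f(x+h)-f(x)$ is a polynomial map of degree $\le d-1$. $\mathbb{P}(H,G)$ is the set of all polynomial maps $f:H\to G$ with $f(0)=0$. *)

theory Defs
  imports "HOL-Algebra.Product_Groups" "HOL-Algebra.Coset" "HOL-Library.Disjoint_Sets"
    "HOL-Library.Countable_Set"
begin

text \<open>
  A semigroup is a HOL-Algebra record of which only the carrier and the multiplication are used; the
  field \<^const>\<open>one\<close> is unconstrained (a semigroup need not have an identity) until the record is
  assumed to be a \<^const>\<open>group\<close>. Following HOL-Algebra, semigroups and abelian groups are written
  multiplicatively: \<open>x \<otimes> y\<close> is $x + y$, and \<open>x \<otimes> inv y\<close> is $x - y$.
\<close>

locale comm_semigroup =
  fixes G (structure)
  assumes m_closed: "\<lbrakk>x \<in> carrier G; y \<in> carrier G\<rbrakk> \<Longrightarrow> x \<otimes> y \<in> carrier G"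
    and m_assoc: "\<lbrakk>x \<in> carrier G; y \<in> carrier G; z \<in> carrier G\<rbrakk>
      \<Longrightarrow> (x \<otimes> y) \<otimes> z = x \<otimes> (y \<otimes> z)"
    and m_comm: "\<lbrakk>x \<in> carrier G; y \<in> carrier G\<rbrakk> \<Longrightarrow> x \<otimes> y = y \<otimes> x"

text \<open>The set $G \setminus \{0\}$, which is $G$ if there is no identity; the possibly meaningless
  field \<^const>\<open>one\<close> is deliberately avoided.\<close>

definition nonidentity :: "('a, 'b) monoid_scheme \<Rightarrow> 'a set" where
  "nonidentity G =
     {x \<in> carrier G. \<not> (\<forall>y \<in> carrier G. x \<otimes>\<^bsub>G\<^esub> y = y \<and> y \<otimes>\<^bsub>G\<^esub> x = y)}"

text \<open>$G^j$ with coordinates indexed by $0, \dots, j-1$; its elements are extensional functions.\<close>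

abbreviation power_structure :: "('a, 'b) monoid_scheme \<Rightarrow> nat \<Rightarrow> (nat \<Rightarrow> 'a) monoid" where
  "power_structure G j \<equiv> product_group {..<j} (\<lambda>_. G)"

definition shape ::
  "('a, 'b) monoid_scheme \<Rightarrow> nat \<Rightarrow> (nat \<Rightarrow> ((nat \<Rightarrow> 'a) \<Rightarrow> 'a) set) \<Rightarrow> ('a \<Rightarrow> 'a) \<Rightarrow> bool" where
  "shape G m F c \<longleftrightarrow>
     1 \<le> m \<and> c \<in> hom G G \<and>
     (\<forall>j \<in> {1..m}. finite (F j) \<and> F j \<subseteq> (carrier (power_structure G j) \<rightarrow> carrier G))"

definition shape_set ::
  "('a, 'b) monoid_scheme \<Rightarrow> nat \<Rightarrow> (nat \<Rightarrow> ((nat \<Rightarrow> 'a) \<Rightarrow> 'a) set) \<Rightarrow> ('a \<Rightarrow> 'a) \<Rightarrow>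
    (nat \<Rightarrow> 'a) \<Rightarrow> 'a set" where
  "shape_set G m F c s =
     {c (s 0)} \<union> (\<Union>j \<in> {1..m}. {f (restrict s {..<j}) \<otimes>\<^bsub>G\<^esub> c (s j) | f. f \<in> F j})"

definition partition_regular ::
  "('a, 'b) monoid_scheme \<Rightarrow> nat \<Rightarrow> (nat \<Rightarrow> ((nat \<Rightarrow> 'a) \<Rightarrow> 'a) set) \<Rightarrow> ('a \<Rightarrow> 'a) \<Rightarrow> bool" where
  "partition_regular G m F c \<longleftrightarrow>
     (\<forall>P. finite P \<and> partition_on (carrier G) P \<longrightarrow>
       (\<exists>C \<in> P. \<exists>s \<in> {..m} \<rightarrow>\<^sub>E nonidentity G. shape_set G m F c s \<subseteq> C))"

text \<open>\<open>poly_degree H G d f\<close>: on the carriers, \<open>f\<close> is a polynomial map of degree exactly \<open>d\<close>.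
  That \<open>f\<close> maps \<^term>\<open>carrier H\<close> into \<^term>\<open>carrier G\<close> is required separately, in
  \<open>poly_maps\<close> below.\<close>

fun poly_degree ::
  "('a, 'c) monoid_scheme \<Rightarrow> ('b, 'd) monoid_scheme \<Rightarrow> nat \<Rightarrow> ('a \<Rightarrow> 'b) \<Rightarrow> bool" where
  "poly_degree H G 0 f \<longleftrightarrow> (\<exists>a \<in> carrier G. \<forall>x \<in> carrier H. f x = a)"
| "poly_degree H G (Suc d) f \<longleftrightarrow>
     \<not> (\<exists>i \<in> {..d}. poly_degree H G i f) \<and>
     (\<forall>h \<in> carrier H. \<exists>i \<in> {..d}. poly_degree H G i (\<lambda>x. f (x \<otimes>\<^bsub>H\<^esub> h) \<otimes>\<^bsub>G\<^esub> inv\<^bsub>G\<^esub> f x))"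

definition poly_maps ::
  "('a, 'c) monoid_scheme \<Rightarrow> ('b, 'd) monoid_scheme \<Rightarrow> ('a \<Rightarrow> 'b) set" where
  "poly_maps H G =
     {f \<in> carrier H \<rightarrow> carrier G. (\<exists>d. poly_degree H G d f) \<and> f \<one>\<^bsub>H\<^esub> = \<one>\<^bsub>G\<^esub>}"

end

theory Submission
  imports Defs
begin

text \<open>
  Fix a colouring and put \<open>m r + 1\<close> levels instead of \<open>m + 1\<close>. By the pigeonhole principle it suffices to find
  $s_0, s_1, \dots$ such that the colour of $f(s_0, \dots, s_{j-1}) + c(s_j)$ depends only on the
  level $j$, for all $f$ in a finite family closed under selecting coordinates. These tuples are
  built level by level, with the claim strengthened to long lists of tuples all of whose finite
  sums are good. Passing to the next level uses a van der Waerden type recurrence theorem: along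
  every sufficiently long list $h_1, \dots, h_N$ there are $b$ and a finite sum $u$ of the $h_i$
  such that $f(u) + c(b)$ has the colour of $c(b)$ for all $f$. It is essential that $N$ and the number of
  candidates for $b$ depend only on the number of functions and colours, because the list at one level is only known
  after its length has been chosen. For homomorphisms the recurrence theorem is
  proved in the manner of Hales--Jewett, for polynomial maps by colour focusing and PET induction.
\<close>

text \<open>The recurrence theorem returns some finite sum \<open>u\<close> of the list, and which
  one depends on the colouring. A single good tuple could not be extended; a list all of whose
  finite sums are good can be, and the extensions have to form such a list again. All the inductions
  share one device. The given list is cut in two. From its later part come \<open>b\<close> and
  \<open>u\<close> that leave the colour unchanged at every point which the earlier part may
  produce; only then is the earlier part used, for the colouring translated by \<open>b\<close>. The
  points to be protected must therefore be known before the colouring is, which is why each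
  statement provides finitely many candidates that serve all colourings. Protecting \<open>n\<close>
  points amounts to recurrence with \<open>r ^ Suc n\<close> colours, so only the number of points
  matters when \<open>N\<close> and \<open>C\<close> are chosen. Uniformity over all families of a
  given size is forced too: the functions to be controlled at a later stage are increments of the
  given ones at elements found earlier. For polynomial maps it is available because a degree and a
  size already determine a weight.\<close>

section \<open>Finite sums and recurrent families\<close>

text \<open>Sums over the nonempty sublists only, so that no identity is needed.\<close>

fun subsums :: "('a, 'b) monoid_scheme \<Rightarrow> 'a list \<Rightarrow> 'a set" where
  "subsums G [] = {}"
| "subsums G (x # xs) = insert x (subsums G xs \<union> (\<lambda>y. x \<otimes>\<^bsub>G\<^esub> y) ` subsums G xs)"

lemma finite_subsums [simp]: "finite (subsums G xs)"
  by (induction xs) auto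

lemma card_subsums_le: "card (subsums G xs) \<le> 2 ^ length xs - 1"
proof (induction xs)
  case (Cons x xs)
  have "card (subsums G (x # xs))
      \<le> Suc (card (subsums G xs \<union> (\<lambda>y. x \<otimes>\<^bsub>G\<^esub> y) ` subsums G xs))"
    by (simp add: card_insert_if)
  also have "\<dots> \<le> Suc (card (subsums G xs) + card (subsums G xs))"
    by (meson Suc_le_mono add_le_mono card_Un_le card_image_le finite_subsums le_trans order_refl)
  also have "\<dots> \<le> Suc ((2 ^ length xs - 1) + (2 ^ length xs - 1))"
    using Cons.IH by simp
  also have "\<dots> = 2 ^ length (x # xs) - 1"
    using one_le_power[of "2::nat" "length xs"] by (simp only: length_Cons power_Suc) linarith
  finally show ?case .
qed auto

lemma card_subsums: "card (subsums G xs) \<le> 2 ^ length xs"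
  using card_subsums_le[of G xs] by linarith

lemma card_image_prod_le:
  assumes "finite A" "finite B" "card A \<le> a" "card B \<le> b"
  shows "finite ((\<lambda>(x, y). h x y) ` (A \<times> B))" "card ((\<lambda>(x, y). h x y) ` (A \<times> B)) \<le> a * b"
proof -
  show "finite ((\<lambda>(x, y). h x y) ` (A \<times> B))"
    using assms by simp
  have "card ((\<lambda>(x, y). h x y) ` (A \<times> B)) \<le> card (A \<times> B)"
    using assms by (intro card_image_le) simp
  also have "\<dots> \<le> a * b"
    using assms by (simp add: card_cartesian_product mult_le_mono)
  finally show "card ((\<lambda>(x, y). h x y) ` (A \<times> B)) \<le> a * b" .
qed

text \<open>The bound is \<open>r ^ n\<close> and not \<open>r ^ card I\<close> so that the number
  of colours can be fixed before \<open>I\<close> is known; enlarging the exponent is what needs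
  \<open>0 < r\<close>.\<close>

lemma product_coloring:
  fixes \<chi> :: "'i \<Rightarrow> 'x \<Rightarrow> nat"
  assumes "finite I" "card I \<le> n" "0 < r" and \<chi>: "\<And>i. i \<in> I \<Longrightarrow> \<chi> i \<in> X \<rightarrow> {..<r}"
  obtains \<psi> where "\<psi> \<in> X \<rightarrow> {..<r ^ n}"
    and "\<And>x y i. \<lbrakk>x \<in> X; y \<in> X; \<psi> x = \<psi> y; i \<in> I\<rbrakk> \<Longrightarrow> \<chi> i x = \<chi> i y"
proof -
  define T where "T = I \<rightarrow>\<^sub>E {..<r}"
  have "finite T" and cT: "card T = r ^ card I"
    using \<open>finite I\<close> by (auto simp: T_def finite_PiE card_PiE)
  then obtain g where g: "bij_betw g T {0..<card T}"
    using ex_bij_betw_finite_nat by blast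
  define \<psi> where "\<psi> x = g (\<lambda>i\<in>I. \<chi> i x)" for x
  have mem: "(\<lambda>i\<in>I. \<chi> i x) \<in> T" if "x \<in> X" for x
    using \<chi> that unfolding T_def by (fastforce intro!: restrict_PiE_iff[THEN iffD2])
  have "r ^ card I \<le> r ^ n"
    using assms by (simp add: power_increasing)
  then have "\<psi> \<in> X \<rightarrow> {..<r ^ n}"
    using bij_betw_apply[OF g] mem cT unfolding \<psi>_def by (fastforce)
  moreover have "\<chi> i x = \<chi> i y" if "x \<in> X" "y \<in> X" "\<psi> x = \<psi> y" "i \<in> I" for x y i
  proof -
    have "(\<lambda>i\<in>I. \<chi> i x) = (\<lambda>i\<in>I. \<chi> i y)"
      using that g mem unfolding \<psi>_def bij_betw_def inj_on_def by blast
    then show ?thesis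
      using \<open>i \<in> I\<close> by (metis restrict_apply')
  qed
  ultimately show thesis
    using that by blast
qed

text \<open>The order of quantifiers matters: \<open>N\<close> and \<open>C\<close> are chosen before \<open>F\<close> and \<open>hs\<close>, and the
  candidates \<open>K\<close> before the colouring.\<close>

definition recurrent_bound ::
  "('h, 'x) monoid_scheme \<Rightarrow> ('a, 'y) monoid_scheme \<Rightarrow> ('h \<Rightarrow> 'a) set set \<Rightarrow> ('a \<Rightarrow> 'a) \<Rightarrow>
    nat \<Rightarrow> nat \<Rightarrow> nat \<Rightarrow> nat \<Rightarrow> bool" where
  "recurrent_bound H G \<FF> c l r N C \<longleftrightarrow>
     (\<forall>F hs. F \<in> \<FF> \<and> F \<subseteq> carrier H \<rightarrow> carrier G \<and> finite F \<and> card F \<le> l \<and>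
         set hs \<subseteq> carrier H \<and> length hs = N \<longrightarrow>
       (\<exists>K. K \<subseteq> carrier G \<and> finite K \<and> card K \<le> C \<and>
         (\<forall>\<chi> \<in> carrier G \<rightarrow> {..<r}. \<exists>b \<in> K. \<exists>u \<in> subsums H hs. \<forall>f \<in> F.
            \<chi> (f u \<otimes>\<^bsub>G\<^esub> c b) = \<chi> (c b))))"

definition recurrent ::
  "('h, 'x) monoid_scheme \<Rightarrow> ('a, 'y) monoid_scheme \<Rightarrow> ('h \<Rightarrow> 'a) set set \<Rightarrow> ('a \<Rightarrow> 'a) \<Rightarrow>
    nat \<Rightarrow> bool" where
  "recurrent H G \<FF> c l \<longleftrightarrow> (\<forall>r. \<exists>N C. recurrent_bound H G \<FF> c l r N C)"

lemma recurrent_boundI: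
  assumes "\<And>F hs. \<lbrakk>F \<in> \<FF>; F \<subseteq> carrier H \<rightarrow> carrier G; finite F; card F \<le> l; set hs \<subseteq> carrier H;
        length hs = N\<rbrakk> \<Longrightarrow>
      \<exists>K. K \<subseteq> carrier G \<and> finite K \<and> card K \<le> C \<and>
        (\<forall>\<chi> \<in> carrier G \<rightarrow> {..<r}. \<exists>b \<in> K. \<exists>u \<in> subsums H hs. \<forall>f \<in> F.
            \<chi> (f u \<otimes>\<^bsub>G\<^esub> c b) = \<chi> (c b))"
  shows "recurrent_bound H G \<FF> c l r N C"
  unfolding recurrent_bound_def by (intro allI impI, elim conjE, rule assms)

lemma recurrent_boundE:
  assumes "recurrent_bound H G \<FF> c l r N C"
    and "F \<in> \<FF>" "F \<subseteq> carrier H \<rightarrow> carrier G" "finite F" "card F \<le> l"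
    and "set hs \<subseteq> carrier H" "length hs = N"
  obtains K where "K \<subseteq> carrier G" "finite K" "card K \<le> C"
    and "\<And>\<chi>. \<chi> \<in> carrier G \<rightarrow> {..<r} \<Longrightarrow> \<exists>b \<in> K. \<exists>u \<in> subsums H hs. \<forall>f \<in> F.
            \<chi> (f u \<otimes>\<^bsub>G\<^esub> c b) = \<chi> (c b)"
proof -
  have "\<exists>K. K \<subseteq> carrier G \<and> finite K \<and> card K \<le> C \<and>
        (\<forall>\<chi> \<in> carrier G \<rightarrow> {..<r}. \<exists>b \<in> K. \<exists>u \<in> subsums H hs. \<forall>f \<in> F.
            \<chi> (f u \<otimes>\<^bsub>G\<^esub> c b) = \<chi> (c b))"
    using assms(1)[unfolded recurrent_bound_def, rule_format, of F hs] assms(2-) by simp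
  then show thesis
    using that by (elim exE conjE) (rule that, auto)
qed

section \<open>Recurrence that survives translations\<close>

definition shift_recurrent_bound ::
  "('h, 'x) monoid_scheme \<Rightarrow> ('a, 'y) monoid_scheme \<Rightarrow> ('h \<Rightarrow> 'a) set set \<Rightarrow> ('a \<Rightarrow> 'a) \<Rightarrow>
    nat \<Rightarrow> nat \<Rightarrow> nat \<Rightarrow> nat \<Rightarrow> nat \<Rightarrow> bool" where
  "shift_recurrent_bound H G \<FF> c l r n N C \<longleftrightarrow>
     (\<forall>F hs. F \<in> \<FF> \<and> F \<subseteq> carrier H \<rightarrow> carrier G \<and> finite F \<and> card F \<le> l \<and>
         set hs \<subseteq> carrier H \<and> length hs = N \<longrightarrow>
       (\<exists>K. K \<subseteq> carrier G \<and> finite K \<and> card K \<le> C \<and>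
         (\<forall>\<chi> \<in> carrier G \<rightarrow> {..<r}. \<forall>Y. Y \<subseteq> carrier G \<and> finite Y \<and> card Y \<le> n \<longrightarrow>
            (\<exists>b \<in> K. \<exists>u \<in> subsums H hs. \<forall>f \<in> F. \<chi> (f u \<otimes>\<^bsub>G\<^esub> c b) = \<chi> (c b) \<and>
               (\<forall>y \<in> Y. \<chi> (y \<otimes>\<^bsub>G\<^esub> (f u \<otimes>\<^bsub>G\<^esub> c b)) = \<chi> (y \<otimes>\<^bsub>G\<^esub> c b))))))"

lemma shift_recurrent_boundE:
  assumes "shift_recurrent_bound H G \<FF> c l r n N C"
    and "F \<in> \<FF>" "F \<subseteq> carrier H \<rightarrow> carrier G" "finite F" "card F \<le> l"
    and "set hs \<subseteq> carrier H" "length hs = N"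
  obtains K where "K \<subseteq> carrier G" "finite K" "card K \<le> C"
    and "\<And>\<chi> Y. \<lbrakk>\<chi> \<in> carrier G \<rightarrow> {..<r}; Y \<subseteq> carrier G; finite Y; card Y \<le> n\<rbrakk> \<Longrightarrow>
      \<exists>b \<in> K. \<exists>u \<in> subsums H hs. \<forall>f \<in> F. \<chi> (f u \<otimes>\<^bsub>G\<^esub> c b) = \<chi> (c b) \<and>
        (\<forall>y \<in> Y. \<chi> (y \<otimes>\<^bsub>G\<^esub> (f u \<otimes>\<^bsub>G\<^esub> c b)) = \<chi> (y \<otimes>\<^bsub>G\<^esub> c b))"
proof -
  have "\<exists>K. K \<subseteq> carrier G \<and> finite K \<and> card K \<le> C \<and>
        (\<forall>\<chi> \<in> carrier G \<rightarrow> {..<r}. \<forall>Y. Y \<subseteq> carrier G \<and> finite Y \<and> card Y \<le> n \<longrightarrow>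
            (\<exists>b \<in> K. \<exists>u \<in> subsums H hs. \<forall>f \<in> F. \<chi> (f u \<otimes>\<^bsub>G\<^esub> c b) = \<chi> (c b) \<and>
               (\<forall>y \<in> Y. \<chi> (y \<otimes>\<^bsub>G\<^esub> (f u \<otimes>\<^bsub>G\<^esub> c b)) = \<chi> (y \<otimes>\<^bsub>G\<^esub> c b))))"
    using assms(1)[unfolded shift_recurrent_bound_def, rule_format, of F hs] assms(2-) by simp
  then show thesis
    using that by (elim exE conjE) (rule that, auto)
qed

context comm_semigroup
begin

lemma m_lcomm: "\<lbrakk>x \<in> carrier G; y \<in> carrier G; z \<in> carrier G\<rbrakk> \<Longrightarrow> x \<otimes> (y \<otimes> z) = y \<otimes> (x \<otimes> z)"
  by (metis m_assoc m_comm)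

lemmas m_ac = m_assoc m_comm m_lcomm

lemma subsums_closed: "set xs \<subseteq> carrier G \<Longrightarrow> subsums G xs \<subseteq> carrier G"
  by (induction xs) (auto simp: m_closed subset_iff)

lemma subsums_append:
  assumes "set xs \<subseteq> carrier G" "set ys \<subseteq> carrier G"
  shows "subsums G (xs @ ys) =
    subsums G xs \<union> subsums G ys \<union> (\<Union>u \<in> subsums G xs. (\<lambda>v. u \<otimes> v) ` subsums G ys)"
  using assms
proof (induction xs)
  case (Cons x xs)
  have "x \<otimes> (u \<otimes> v) = x \<otimes> u \<otimes> v" if "u \<in> subsums G xs" "v \<in> subsums G ys" for u v
    using Cons.prems subsums_closed[of xs] subsums_closed[of ys] that by (simp add: m_assoc subset_iff)
  then have "(\<lambda>y. x \<otimes> y) ` (\<Union>u \<in> subsums G xs. (\<lambda>v. u \<otimes> v) ` subsums G ys)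
      = (\<Union>u \<in> (\<lambda>y. x \<otimes> y) ` subsums G xs. (\<lambda>v. u \<otimes> v) ` subsums G ys)"
    by (simp add: image_UN image_image)
  then show ?case
    using Cons by (simp add: image_Un) blast
qed simp

text \<open>An element \<open>x\<close> is coloured by the tuple of the colours of \<open>x\<close>
  and of all \<open>y \<otimes> x\<close> with \<open>y\<close> in \<open>Y\<close>. At most
  \<open>r ^ Suc n\<close> colours occur, so \<open>N\<close> and \<open>C\<close> depend on
  \<open>Y\<close> only through \<open>n\<close>, although \<open>Y\<close> will be built from a
  list that is given later.\<close>

lemma recurrent_shift:
  assumes rec: "recurrent H G \<FF> c l" and c: "c \<in> carrier G \<rightarrow> carrier G" and H: "comm_semigroup H"
  obtains N C where "shift_recurrent_bound H G \<FF> c l r n N C"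
proof -
  obtain N C where NC: "recurrent_bound H G \<FF> c l (r ^ Suc n) N C"
    using rec unfolding recurrent_def by blast
  have "shift_recurrent_bound H G \<FF> c l r n N C"
    unfolding shift_recurrent_bound_def
  proof (intro allI impI; elim conjE)
    fix F and hs :: "'c list"
    assume F: "F \<in> \<FF>" "F \<subseteq> carrier H \<rightarrow> carrier G" "finite F" "card F \<le> l"
      and hs: "set hs \<subseteq> carrier H" "length hs = N"
    obtain K where K: "K \<subseteq> carrier G" "finite K" "card K \<le> C"
      and *: "\<And>\<chi>. \<chi> \<in> carrier G \<rightarrow> {..<r ^ Suc n} \<Longrightarrow> \<exists>b \<in> K. \<exists>u \<in> subsums H hs. \<forall>f \<in> F.
            \<chi> (f u \<otimes> c b) = \<chi> (c b)"
      using recurrent_boundE[OF NC F hs] by metis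
    have "\<exists>b \<in> K. \<exists>u \<in> subsums H hs. \<forall>f \<in> F. \<chi> (f u \<otimes> c b) = \<chi> (c b) \<and>
             (\<forall>y \<in> Y. \<chi> (y \<otimes> (f u \<otimes> c b)) = \<chi> (y \<otimes> c b))"
      if \<chi>: "\<chi> \<in> carrier G \<rightarrow> {..<r}" and Y: "Y \<subseteq> carrier G" "finite Y" "card Y \<le> n" for \<chi> Y
    proof (cases "carrier G = {}")
      case True
      then show ?thesis using *[of \<chi>] K by auto
    next
      case False
      then have "0 < r" using \<chi> by fastforce
      \<comment> \<open>\<open>None\<close> stands for the untranslated colour, since there may be
        no identity to put into \<open>Y\<close>.\<close>
      define I where "I = insert None (Some ` Y)"
      define \<phi> where "\<phi> i x = (case i of None \<Rightarrow> \<chi> x | Some y \<Rightarrow> \<chi> (y \<otimes> x))" for i x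
      have "finite I" "card I \<le> Suc n"
        using Y by (auto simp: I_def card_image card_insert_if)
      moreover have "\<phi> i \<in> carrier G \<rightarrow> {..<r}" if "i \<in> I" for i
        using that \<chi> Y by (fastforce simp: I_def \<phi>_def intro!: m_closed)
      ultimately obtain \<psi> where \<psi>: "\<psi> \<in> carrier G \<rightarrow> {..<r ^ Suc n}"
        and eq: "\<And>x y i. \<lbrakk>x \<in> carrier G; y \<in> carrier G; \<psi> x = \<psi> y; i \<in> I\<rbrakk> \<Longrightarrow> \<phi> i x = \<phi> i y"
        using product_coloring[of I "Suc n" r \<phi> "carrier G"] \<open>0 < r\<close> by blast
      obtain b u where bu: "b \<in> K" "u \<in> subsums H hs" "\<And>f. f \<in> F \<Longrightarrow> \<psi> (f u \<otimes> c b) = \<psi> (c b)"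
        using *[OF \<psi>] by blast
      have cl: "u \<in> carrier H" "c b \<in> carrier G"
        using bu comm_semigroup.subsums_closed[OF H hs(1)] K c by auto
      have eq': "\<phi> i (f u \<otimes> c b) = \<phi> i (c b)" if "f \<in> F" "i \<in> I" for f i
      proof (rule eq)
        show "f u \<otimes> c b \<in> carrier G"
          using that(1) cl F(2) by (intro m_closed) auto
      qed (use that cl bu in auto)
      have "\<chi> (f u \<otimes> c b) = \<chi> (c b)" if "f \<in> F" for f
        using eq'[OF that, of None] by (simp add: \<phi>_def I_def)
      moreover have "\<chi> (y \<otimes> (f u \<otimes> c b)) = \<chi> (y \<otimes> c b)" if "f \<in> F" "y \<in> Y" for f y
        using eq'[OF that(1), of "Some y"] that by (simp add: \<phi>_def I_def)
      ultimately show ?thesis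
        using bu(1,2) by blast
    qed
    then show "\<exists>K. K \<subseteq> carrier G \<and> finite K \<and> card K \<le> C \<and>
        (\<forall>\<chi> \<in> carrier G \<rightarrow> {..<r}. \<forall>Y. Y \<subseteq> carrier G \<and> finite Y \<and> card Y \<le> n \<longrightarrow>
          (\<exists>b \<in> K. \<exists>u \<in> subsums H hs. \<forall>f \<in> F. \<chi> (f u \<otimes> c b) = \<chi> (c b) \<and>
             (\<forall>y \<in> Y. \<chi> (y \<otimes> (f u \<otimes> c b)) = \<chi> (y \<otimes> c b))))"
      using K by (intro exI[of _ K]) simp
  qed
  then show thesis
    using that by blast
qed

end

section \<open>Homomorphisms\<close>

context comm_semigroup
begin

primrec chain_points :: "('h \<Rightarrow> 'a) \<Rightarrow> 'a \<Rightarrow> 'h list \<Rightarrow> 'a list" where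
  "chain_points g a [] = [a]"
| "chain_points g a (v # vs) = a # chain_points g (g v \<otimes> a) vs"

text \<open>The points of a chain differ by values of \<open>g\<close> at sums of consecutive elements of the list. Hence two
  points of the same colour supply the value of \<open>g\<close> that the invariance under \<open>F\<close> leaves open.\<close>

primrec chain ::
  "('h, 'x) monoid_scheme \<Rightarrow> ('h \<Rightarrow> 'a) set \<Rightarrow> ('h \<Rightarrow> 'a) \<Rightarrow> ('a \<Rightarrow> 'c) \<Rightarrow> 'a \<Rightarrow> 'h list \<Rightarrow> bool" where
  "chain H F g \<chi> a [] \<longleftrightarrow> True"
| "chain H F g \<chi> a (v # vs) \<longleftrightarrow>
     (\<forall>u \<in> subsums H (v # vs). \<forall>f \<in> F. \<chi> (f u \<otimes> a) = \<chi> a) \<and> chain H F g \<chi> (g v \<otimes> a) vs"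

lemma length_chain_points [simp]: "length (chain_points g a vs) = Suc (length vs)"
  by (induction vs arbitrary: a) auto

lemma chain_points_closed:
  assumes "g \<in> carrier H \<rightarrow> carrier G" "a \<in> carrier G" "set vs \<subseteq> carrier H"
  shows "set (chain_points g a vs) \<subseteq> carrier G"
  using assms(2,3)
proof (induction vs arbitrary: a)
  case (Cons v vs)
  then have "g v \<otimes> a \<in> carrier G"
    using assms(1) by (intro m_closed) auto
  then show ?case
    using Cons by simp
qed simp

lemma chain_points_cases:
  assumes g: "g \<in> hom H G" and "a \<in> carrier G" "set vs \<subseteq> carrier H" and H: "comm_semigroup H"
    and "x \<in> set (chain_points g a vs)"
  shows "x = a \<or> (\<exists>u \<in> subsums H vs. x = g u \<otimes> a)"
  using assms(2,3,5)
proof (induction vs arbitrary: a)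
  case (Cons v vs)
  have v: "v \<in> carrier H" "g v \<in> carrier G" "set vs \<subseteq> carrier H"
    using Cons.prems g by (auto simp: hom_def)
  then have "g v \<otimes> a \<in> carrier G"
    using Cons.prems by (simp add: m_closed)
  consider "x = a" | "x = g v \<otimes> a" | u where "u \<in> subsums H vs" "x = g u \<otimes> (g v \<otimes> a)"
    using Cons.IH[OF \<open>g v \<otimes> a \<in> carrier G\<close> v(3)] Cons.prems(3) by auto
  then show ?case
  proof cases
    case 3
    then have "u \<in> carrier H"
      using comm_semigroup.subsums_closed[OF H v(3)] by auto
    then have "g u \<otimes> (g v \<otimes> a) = g (v \<otimes>\<^bsub>H\<^esub> u) \<otimes> a"
      using v g Cons.prems(1) by (simp add: hom_mult m_ac hom_in_carrier m_closed)
    then show ?thesis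
      using 3 by auto
  qed auto
qed simp

text \<open>\<open>u\<close> is the sum of the entries between two points of equal colour. It is
  also a sum of entries still ahead at the earlier point, so the functions in \<open>F\<close>
  preserve the colour there.\<close>

lemma chain_pigeonhole:
  assumes g: "g \<in> hom H G" and "a \<in> carrier G" "set vs \<subseteq> carrier H" and H: "comm_semigroup H"
    and "chain H F g \<chi> a vs" and "\<not> distinct (map \<chi> (chain_points g a vs))"
  shows "\<exists>p \<in> set (chain_points g a vs). \<exists>u \<in> subsums H vs. \<forall>f \<in> insert g F. \<chi> (f u \<otimes> p) = \<chi> p"
  using assms(2,3,5,6)
proof (induction vs arbitrary: a)
  case (Cons v vs)
  have v: "g v \<otimes> a \<in> carrier G" "set vs \<subseteq> carrier H"
    using Cons.prems g by (auto simp: hom_def intro!: m_closed)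
  have point_cases: "\<exists>u \<in> subsums H (v # vs). x = g u \<otimes> a"
    if x: "x \<in> set (chain_points g (g v \<otimes> a) vs)" for x
    using chain_points_cases[OF g v H x]
  proof (elim disjE bexE)
    fix u
    assume u: "u \<in> subsums H vs" "x = g u \<otimes> (g v \<otimes> a)"
    then have "u \<in> carrier H" "v \<in> carrier H"
      using comm_semigroup.subsums_closed[OF H v(2)] Cons.prems(2) by auto
    then have "x = g (v \<otimes>\<^bsub>H\<^esub> u) \<otimes> a"
      using u g Cons.prems(1) by (simp add: hom_mult m_ac hom_in_carrier m_closed)
    then show ?thesis
      using u by auto
  qed auto
  show ?case
  proof (cases "distinct (map \<chi> (chain_points g (g v \<otimes> a) vs))")
    case True
    then obtain x where x: "x \<in> set (chain_points g (g v \<otimes> a) vs)" "\<chi> x = \<chi> a"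
      using Cons.prems(4) by fastforce
    then obtain u where u: "u \<in> subsums H (v # vs)" "x = g u \<otimes> a"
      using point_cases by blast
    then show ?thesis
      using x Cons.prems(3) by (intro bexI[of _ a] bexI[of _ u]) auto
  next
    case False
    then show ?thesis
      using Cons.IH[OF v] Cons.prems(3) by auto
  qed
qed simp

text \<open>All points move by \<open>b\<close> and one point is added at the end, where nothing is
  demanded. Sums without \<open>v\<close> are settled by the chain for the translated colouring,
  \<open>v\<close> alone by \<open>pts\<close>. For the others, additivity gives \<open>f (u
  \<otimes> v) \<otimes> (a \<otimes> b) = (f u \<otimes> a) \<otimes> (f v \<otimes> b)\<close>:
  \<open>pts'\<close> removes \<open>f v\<close>, and then the old chain removes
  \<open>f u\<close>.\<close>

lemma chain_snoc:
  assumes F: "F \<subseteq> hom H G" and g: "g \<in> hom H G" and H: "comm_semigroup H"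
    and a: "a \<in> carrier G" and b: "b \<in> carrier G" and vs: "set vs \<subseteq> carrier H" and v: "v \<in> carrier H"
    and ch: "chain H F g (\<lambda>x. \<chi> (x \<otimes> b)) a vs"
    and pts: "\<And>p f. \<lbrakk>p \<in> set (chain_points g a vs); f \<in> F\<rbrakk> \<Longrightarrow> \<chi> (p \<otimes> (f v \<otimes> b)) = \<chi> (p \<otimes> b)"
    and pts': "\<And>p f f' u. \<lbrakk>p \<in> set (chain_points g a vs); u \<in> subsums H vs; f \<in> F; f' \<in> F\<rbrakk> \<Longrightarrow>
      \<chi> ((f' u \<otimes> p) \<otimes> (f v \<otimes> b)) = \<chi> ((f' u \<otimes> p) \<otimes> b)"
  shows "chain H F g \<chi> (a \<otimes> b) (vs @ [v])"
  using a vs ch pts pts'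
proof (induction vs arbitrary: a)
  case Nil
  have "\<chi> (f v \<otimes> (a \<otimes> b)) = \<chi> (a \<otimes> b)" if "f \<in> F" for f
    using Nil.prems(4)[of a f] that F Nil.prems(1) b v
    by (auto simp: m_lcomm hom_in_carrier subset_iff)
  then show ?case by simp
next
  case (Cons w ws)
  have w: "w \<in> carrier H" "set ws \<subseteq> carrier H" "g w \<in> carrier G" "g w \<otimes> a \<in> carrier G"
    using Cons.prems(1,2) g by (auto simp: hom_def intro!: m_closed)
  have cl: "f u \<in> carrier G" if "f \<in> F" "u \<in> carrier H" for f u
    using that F by (auto simp: hom_def)
  have scl: "u \<in> carrier H" if "u \<in> subsums H (w # ws)" for u
    using comm_semigroup.subsums_closed[OF H Cons.prems(2)] that by blast
  have old: "\<chi> (f u \<otimes> (a \<otimes> b)) = \<chi> (a \<otimes> b)" if "u \<in> subsums H (w # ws)" "f \<in> F" for f u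
  proof -
    have "\<chi> ((f u \<otimes> a) \<otimes> b) = \<chi> (a \<otimes> b)"
      using Cons.prems(3) that unfolding chain.simps by blast
    then show ?thesis
      using cl[OF that(2) scl[OF that(1)]] Cons.prems(1) b by (simp add: m_assoc)
  qed
  have vv: "\<chi> (f v \<otimes> (a \<otimes> b)) = \<chi> (a \<otimes> b)" if "f \<in> F" for f
    using Cons.prems(4)[of a f] that cl[OF that v] Cons.prems(1) b v
    by (auto simp: m_lcomm)
  have uv: "\<chi> (f (u \<otimes>\<^bsub>H\<^esub> v) \<otimes> (a \<otimes> b)) = \<chi> (a \<otimes> b)" if u: "u \<in> subsums H (w # ws)" and f: "f \<in> F" for f u
  proof -
    have c: "f u \<in> carrier G" "f v \<in> carrier G" and "f (u \<otimes>\<^bsub>H\<^esub> v) = f u \<otimes> f v"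
      using cl[OF f] scl[OF u] v f F by (auto simp: hom_def)
    then have "f (u \<otimes>\<^bsub>H\<^esub> v) \<otimes> (a \<otimes> b) = (f u \<otimes> a) \<otimes> (f v \<otimes> b)"
      using Cons.prems(1) b by (simp add: m_ac m_closed)
    also have "\<chi> \<dots> = \<chi> ((f u \<otimes> a) \<otimes> b)"
      by (rule Cons.prems(5)) (use u f in auto)
    also have "(f u \<otimes> a) \<otimes> b = f u \<otimes> (a \<otimes> b)"
      using c Cons.prems(1) b by (simp add: m_assoc)
    finally show ?thesis
      using old[OF u f] by simp
  qed
  have "subsums H (w # ws @ [v]) =
      subsums H (w # ws) \<union> {v} \<union> (\<lambda>u. u \<otimes>\<^bsub>H\<^esub> v) ` subsums H (w # ws)"
    using comm_semigroup.subsums_append[OF H Cons.prems(2), of "[v]"] v by auto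
  then have 1: "\<forall>u \<in> subsums H (w # ws @ [v]). \<forall>f \<in> F. \<chi> (f u \<otimes> (a \<otimes> b)) = \<chi> (a \<otimes> b)"
    using old vv uv by blast
  have "chain H F g \<chi> ((g w \<otimes> a) \<otimes> b) (ws @ [v])"
  proof (rule Cons.IH[OF w(4,2)])
    show "chain H F g (\<lambda>x. \<chi> (x \<otimes> b)) (g w \<otimes> a) ws"
      using Cons.prems(3) by simp
  qed (use Cons.prems(4,5) in auto)
  moreover have "(g w \<otimes> a) \<otimes> b = g w \<otimes> (a \<otimes> b)"
    using w b Cons.prems(1) by (simp add: m_assoc)
  ultimately show ?case
    using 1 by simp
qed

definition chain_bound :: "('h, 'x) monoid_scheme \<Rightarrow> nat \<Rightarrow> nat \<Rightarrow> nat \<Rightarrow> nat \<Rightarrow> nat \<Rightarrow> bool" where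
  "chain_bound H l k r N C \<longleftrightarrow>
     (\<forall>F g hs. F \<subseteq> hom H G \<and> g \<in> hom H G \<and> finite F \<and> card F \<le> l \<and>
         set hs \<subseteq> carrier H \<and> length hs = N \<longrightarrow>
       (\<exists>\<K>. (\<forall>(a, vs) \<in> \<K>. a \<in> carrier G \<and> set vs \<subseteq> carrier H \<and> length vs = k \<and>
                subsums H vs \<subseteq> subsums H hs) \<and> finite \<K> \<and> card \<K> \<le> C \<and>
         (\<forall>\<chi> \<in> carrier G \<rightarrow> {..<r}. \<exists>(a, vs) \<in> \<K>. chain H F g \<chi> a vs)))"

text \<open>The entry appended last is found first: \<open>b\<close> and \<open>v\<close> preserve
  the colour at every point that some candidate chain of length \<open>k\<close> can need. The chain
  itself is then chosen for \<open>\<lambda>x. \<chi> (x \<otimes> b)\<close>, which still has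
  \<open>r\<close> colours.\<close>

lemma chain_bound_exists:
  assumes H: "comm_semigroup H" and "carrier G \<noteq> {}"
    and rec: "recurrent H G (Pow (hom H G)) (\<lambda>x. x) l"
  shows "\<exists>N C. chain_bound H l k r N C"
proof (induction k)
  case 0
  obtain a where "a \<in> carrier G"
    using assms by blast
  then have "chain_bound H l 0 r 0 1"
    unfolding chain_bound_def by (intro allI impI exI[of _ "{(a, [])}"]) auto
  then show ?case by blast
next
  case (Suc k)
  then obtain N1 C1 where 1: "chain_bound H l k r N1 C1"
    by blast
  \<comment> \<open>Each of the \<open>C1\<close> candidate chains has \<open>Suc k\<close> points
    \<open>p\<close>, and each point has at most \<open>2 ^ k * l\<close> translates
    \<open>f u \<otimes> p\<close>; these are the points in \<open>pts\<close> and
    \<open>pts'\<close> of \<open>chain_snoc\<close>.\<close>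
  define n where "n = C1 * (Suc k + Suc k * (2 ^ k * l))"
  have id: "(\<lambda>x. x) \<in> carrier G \<rightarrow> carrier G" by simp
  obtain N2 C2 where 2: "shift_recurrent_bound H G (Pow (hom H G)) (\<lambda>x. x) l r n N2 C2"
    by (rule recurrent_shift[OF rec id H])
  have "chain_bound H l (Suc k) r (N1 + N2) (C1 * (C2 * 2 ^ N2))"
    unfolding chain_bound_def
  proof (intro allI impI; elim conjE)
    fix F g and hs :: "'c list"
    assume F: "F \<subseteq> hom H G" and g: "g \<in> hom H G" and finF: "finite F" "card F \<le> l"
      and hs: "set hs \<subseteq> carrier H" "length hs = N1 + N2"
    define hs1 hs2 where "hs1 = take N1 hs" and "hs2 = drop N1 hs"
    have hs12: "hs = hs1 @ hs2" "length hs1 = N1" "length hs2 = N2"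
      using hs by (auto simp: hs1_def hs2_def)
    then have sub: "set hs1 \<subseteq> carrier H" "set hs2 \<subseteq> carrier H"
      using hs by auto
    obtain \<K> where \<K>: "\<And>a vs. (a, vs) \<in> \<K> \<Longrightarrow> a \<in> carrier G \<and> set vs \<subseteq> carrier H \<and> length vs = k \<and>
             subsums H vs \<subseteq> subsums H hs1" and fin\<K>: "finite \<K>" "card \<K> \<le> C1"
      and ch: "\<And>\<chi>. \<chi> \<in> carrier G \<rightarrow> {..<r} \<Longrightarrow> \<exists>a vs. (a, vs) \<in> \<K> \<and> chain H F g \<chi> a vs"
    proof -
      have "\<exists>\<K>. (\<forall>(a, vs) \<in> \<K>. a \<in> carrier G \<and> set vs \<subseteq> carrier H \<and> length vs = k \<and>
                subsums H vs \<subseteq> subsums H hs1) \<and> finite \<K> \<and> card \<K> \<le> C1 \<and>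
         (\<forall>\<chi> \<in> carrier G \<rightarrow> {..<r}. \<exists>(a, vs) \<in> \<K>. chain H F g \<chi> a vs)"
        using 1[unfolded chain_bound_def, rule_format, of F g hs1] F g finF sub(1) hs12(2) by blast
      then show thesis
        by (elim exE conjE) (rule that, auto, fastforce)
    qed
    have "F \<subseteq> carrier H \<rightarrow> carrier G"
      using F by (auto simp: hom_def)
    then obtain K where K: "K \<subseteq> carrier G" "finite K" "card K \<le> C2"
      and rK: "\<And>\<chi> Y. \<lbrakk>\<chi> \<in> carrier G \<rightarrow> {..<r}; Y \<subseteq> carrier G; finite Y; card Y \<le> n\<rbrakk> \<Longrightarrow>
          (\<exists>b \<in> K. \<exists>u \<in> subsums H hs2. \<forall>f \<in> F. \<chi> (f u \<otimes> b) = \<chi> b \<and>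
             (\<forall>y \<in> Y. \<chi> (y \<otimes> (f u \<otimes> b)) = \<chi> (y \<otimes> b)))"
      using shift_recurrent_boundE[OF 2 _ _ finF sub(2) hs12(3)] F by (metis PowI)
    define P where "P = (\<lambda>(a, vs). set (chain_points g a vs))"
    define Q where "Q = (\<lambda>(a, vs). (\<lambda>(p, (u, f)). f u \<otimes> p) ` (P (a, vs) \<times> (subsums H vs \<times> F)))"
    define Y where "Y = (\<Union>x \<in> \<K>. P x \<union> Q x)"
    have gc: "g \<in> carrier H \<rightarrow> carrier G"
      using g by (auto simp: hom_def)
    have Pc: "P (a, vs) \<subseteq> carrier G" if "(a, vs) \<in> \<K>" for a vs
      using chain_points_closed[OF gc] \<K>[OF that] by (simp add: P_def)
    have Qc: "Q (a, vs) \<subseteq> carrier G" if "(a, vs) \<in> \<K>" for a vs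
    proof -
      have "u \<in> carrier H" if "u \<in> subsums H vs" for u
        using \<K>[OF \<open>(a, vs) \<in> \<K>\<close>] comm_semigroup.subsums_closed[OF H, of vs] that by blast
      then show ?thesis
        using Pc[OF that] \<open>F \<subseteq> carrier H \<rightarrow> carrier G\<close> by (auto simp: Q_def intro!: m_closed)
    qed
    have Yc: "Y \<subseteq> carrier G"
      using Pc Qc by (fastforce simp: Y_def)
    have cPQ: "finite (P x \<union> Q x) \<and> card (P x \<union> Q x) \<le> Suc k + Suc k * (2 ^ k * l)" if x: "x \<in> \<K>" for x
    proof -
      obtain a vs where [simp]: "x = (a, vs)" by (cases x)
      have "length vs = k"
        using \<K> x by auto
      have fP: "finite (P x)" "card (P x) \<le> Suc k"
        using card_length[of "chain_points g a vs"] \<open>length vs = k\<close> by (auto simp: P_def)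
      have f1: "finite (subsums H vs \<times> F)" "card (subsums H vs \<times> F) \<le> 2 ^ k * l"
        using finF card_subsums[of H vs] \<open>length vs = k\<close>
        by (auto simp: card_cartesian_product intro!: mult_le_mono)
      have "finite (Q x)" "card (Q x) \<le> Suc k * (2 ^ k * l)"
        using card_image_prod_le[OF fP(1) f1(1) fP(2) f1(2)] by (auto simp: Q_def)
      then show ?thesis
        using fP card_Un_le[of "P x" "Q x"] by fastforce
    qed
    have "finite Y"
      using fin\<K> cPQ by (simp add: Y_def)
    moreover have "card Y \<le> n"
    proof -
      have "card Y \<le> (\<Sum>x\<in>\<K>. card (P x \<union> Q x))"
        unfolding Y_def by (rule card_UN_le[OF fin\<K>(1)])
      also have "\<dots> \<le> (\<Sum>x\<in>\<K>. Suc k + Suc k * (2 ^ k * l))"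
        using cPQ by (intro sum_mono) blast
      also have "\<dots> \<le> n"
        using fin\<K> unfolding n_def sum_constant by (simp only: of_nat_id mult_le_mono1)
      finally show ?thesis .
    qed
    ultimately have rY: "\<exists>b \<in> K. \<exists>u \<in> subsums H hs2. \<forall>f \<in> F. \<forall>y \<in> Y. \<chi> (y \<otimes> (f u \<otimes> b)) = \<chi> (y \<otimes> b)"
      if "\<chi> \<in> carrier G \<rightarrow> {..<r}" for \<chi>
      using rK[OF that Yc] by meson
    define \<L> where "\<L> = (\<lambda>((a, vs), (b, v)). (a \<otimes> b, vs @ [v])) ` (\<K> \<times> (K \<times> subsums H hs2))"
    have fs: "finite (K \<times> subsums H hs2)" "card (K \<times> subsums H hs2) \<le> C2 * 2 ^ N2"
      using K card_subsums[of H hs2] hs12 by (auto simp: card_cartesian_product intro!: mult_le_mono)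
    have \<L>fin: "finite \<L>" "card \<L> \<le> C1 * (C2 * 2 ^ N2)"
      using card_image_prod_le[OF fin\<K>(1) fs(1) fin\<K>(2) fs(2)] unfolding \<L>_def by auto
    have \<L>sub: "\<forall>(a, vs) \<in> \<L>. a \<in> carrier G \<and> set vs \<subseteq> carrier H \<and> length vs = Suc k \<and>
             subsums H vs \<subseteq> subsums H hs"
    proof -
      have "a \<otimes> b \<in> carrier G \<and> set (vs @ [v]) \<subseteq> carrier H \<and> length (vs @ [v]) = Suc k \<and>
             subsums H (vs @ [v]) \<subseteq> subsums H hs"
        if av: "(a, vs) \<in> \<K>" and b: "b \<in> K" and v: "v \<in> subsums H hs2" for a vs b v
      proof -
        have vc: "v \<in> carrier H"
          using v comm_semigroup.subsums_closed[OF H sub(2)] by auto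
        have "subsums H (vs @ [v]) = subsums H vs \<union> {v} \<union> (\<lambda>u. u \<otimes>\<^bsub>H\<^esub> v) ` subsums H vs"
          using comm_semigroup.subsums_append[OF H, of vs "[v]"] vc \<K>[OF av] by auto
        then have "subsums H (vs @ [v]) \<subseteq> subsums H hs"
          using comm_semigroup.subsums_append[OF H sub] hs12 \<K>[OF av] v by auto
        then show ?thesis
          using \<K>[OF av] K b vc by (auto intro: m_closed)
      qed
      then show ?thesis
        unfolding \<L>_def by force
    qed
    have "\<exists>(a, vs) \<in> \<L>. chain H F g \<chi> a vs" if \<chi>: "\<chi> \<in> carrier G \<rightarrow> {..<r}" for \<chi>
    proof -
      obtain b v where b: "b \<in> K" and v: "v \<in> subsums H hs2"
        and inv: "\<And>f y. \<lbrakk>f \<in> F; y \<in> Y\<rbrakk> \<Longrightarrow> \<chi> (y \<otimes> (f v \<otimes> b)) = \<chi> (y \<otimes> b)"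
        using rY[OF \<chi>] by blast
      have bc: "b \<in> carrier G" and vc: "v \<in> carrier H"
        using b K v comm_semigroup.subsums_closed[OF H sub(2)] by auto
      have "(\<lambda>x. \<chi> (x \<otimes> b)) \<in> carrier G \<rightarrow> {..<r}"
        using \<chi> bc m_closed by blast
      from ch[OF this] obtain a vs
        where av: "(a, vs) \<in> \<K>" and ch': "chain H F g (\<lambda>x. \<chi> (x \<otimes> b)) a vs"
        by blast
      have "P (a, vs) \<subseteq> Y" "Q (a, vs) \<subseteq> Y"
        using av by (auto simp: Y_def)
      then have PY: "p \<in> Y" and QY: "\<lbrakk>u \<in> subsums H vs; f \<in> F\<rbrakk> \<Longrightarrow> f u \<otimes> p \<in> Y"
        if "p \<in> set (chain_points g a vs)" for p u f
        using that by (auto simp: P_def Q_def image_subset_iff)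
      have "chain H F g \<chi> (a \<otimes> b) (vs @ [v])"
      proof (rule chain_snoc[OF F g H _ bc _ vc ch'])
        show "a \<in> carrier G" "set vs \<subseteq> carrier H"
          using \<K>[OF av] by auto
      qed (use PY QY inv in blast)+
      moreover have "(a \<otimes> b, vs @ [v]) \<in> \<L>"
        using av b v by (force simp: \<L>_def)
      ultimately show ?thesis by blast
    qed
    with \<L>fin \<L>sub show "\<exists>\<K>. (\<forall>(a, vs) \<in> \<K>. a \<in> carrier G \<and> set vs \<subseteq> carrier H \<and> length vs = Suc k \<and>
             subsums H vs \<subseteq> subsums H hs) \<and> finite \<K> \<and> card \<K> \<le> C1 * (C2 * 2 ^ N2) \<and>
       (\<forall>\<chi> \<in> carrier G \<rightarrow> {..<r}. \<exists>(a, vs) \<in> \<K>. chain H F g \<chi> a vs)"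
      by (intro exI[of _ \<L>]) simp
  qed
  then show ?case by blast
qed

text \<open>Induction on the number of functions: one function \<open>g\<close> is set aside, the
  induction hypothesis builds a chain for the others along \<open>g\<close>, and the pigeonhole
  principle on the chain brings \<open>g\<close> back.\<close>

theorem recurrent_hom:
  assumes H: "comm_semigroup H" and ne: "carrier G \<noteq> {}"
  shows "recurrent H G (Pow (hom H G)) (\<lambda>x. x) l"
proof (induction l)
  case 0
  obtain a where a: "a \<in> carrier G"
    using ne by blast
  have "recurrent_bound H G (Pow (hom H G)) (\<lambda>x. x) 0 r 1 1" for r
  proof (rule recurrent_boundI)
    fix F :: "('c \<Rightarrow> 'a) set" and hs :: "'c list"
    assume "finite F" "card F \<le> 0" "length hs = 1"
    then have "F = {}" "hs ! 0 \<in> subsums H hs"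
      by (auto simp: length_Suc_conv)
    then show "\<exists>K. K \<subseteq> carrier G \<and> finite K \<and> card K \<le> 1 \<and>
        (\<forall>\<chi> \<in> carrier G \<rightarrow> {..<r}. \<exists>b \<in> K. \<exists>u \<in> subsums H hs. \<forall>f \<in> F. \<chi> (f u \<otimes> b) = \<chi> b)"
      using a by (intro exI[of _ "{a}"]) auto
  qed
  then show ?case
    unfolding recurrent_def by blast
next
  case (Suc l)
  show ?case
    unfolding recurrent_def
  proof
    fix r
    \<comment> \<open>A chain of length \<open>r\<close> has \<open>Suc r\<close> points, one more
      than there are colours.\<close>
    obtain N C where NC: "chain_bound H l r r N C"
      using chain_bound_exists[OF H ne Suc] by blast
    \<comment> \<open>The additional list entry and the summand \<open>1\<close> serve the case
      \<open>F = {}\<close>: a sum and a candidate are demanded even if \<open>N\<close> or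
      \<open>C\<close> is zero.\<close>
    have "recurrent_bound H G (Pow (hom H G)) (\<lambda>x. x) (Suc l) r (Suc N) (C * Suc r + 1)"
    proof (rule recurrent_boundI)
      fix F :: "('c \<Rightarrow> 'a) set" and hs :: "'c list"
      assume F: "F \<in> Pow (hom H G)" "finite F" "card F \<le> Suc l"
        and hs: "set hs \<subseteq> carrier H" "length hs = Suc N"
      obtain h hs' where hs': "hs = h # hs'" "length hs' = N"
        using hs by (metis length_Suc_conv)
      show "\<exists>K. K \<subseteq> carrier G \<and> finite K \<and> card K \<le> C * Suc r + 1 \<and>
        (\<forall>\<chi> \<in> carrier G \<rightarrow> {..<r}. \<exists>b \<in> K. \<exists>u \<in> subsums H hs. \<forall>f \<in> F. \<chi> (f u \<otimes> b) = \<chi> b)"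
      proof (cases "F = {}")
        case True
        obtain a where "a \<in> carrier G"
          using ne by blast
        with True show ?thesis
          using hs' by (intro exI[of _ "{a}"]) auto
      next
        case False
        then obtain g where g: "g \<in> F" by blast
        define F0 where "F0 = F - {g}"
        have F0: "F0 \<subseteq> hom H G" "g \<in> hom H G" "finite F0" "card F0 \<le> l" "F = insert g F0"
          using F g by (auto simp: F0_def card_Diff_singleton_if)
        have "set hs' \<subseteq> carrier H"
          using hs hs' by auto
        then obtain \<K> where \<K>: "\<And>a vs. (a, vs) \<in> \<K> \<Longrightarrow> a \<in> carrier G \<and> set vs \<subseteq> carrier H \<and> length vs = r \<and>
                subsums H vs \<subseteq> subsums H hs'"
          and fin: "finite \<K>" "card \<K> \<le> C"
          and ch: "\<And>\<chi>. \<chi> \<in> carrier G \<rightarrow> {..<r} \<Longrightarrow> \<exists>(a, vs) \<in> \<K>. chain H F0 g \<chi> a vs"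
          using NC[unfolded chain_bound_def, rule_format, of F0 g hs'] F0 hs' by fast
        define K where "K = (\<Union>(a, vs) \<in> \<K>. set (chain_points g a vs))"
        have gc: "g \<in> carrier H \<rightarrow> carrier G"
          using F0 by (auto simp: hom_def)
        have "set (chain_points g a vs) \<subseteq> carrier G" if "(a, vs) \<in> \<K>" for a vs
          using chain_points_closed[OF gc] \<K>[OF that] by blast
        then have "K \<subseteq> carrier G"
          by (auto simp: K_def)
        moreover have "finite K"
          using fin by (auto simp: K_def)
        moreover have "card K \<le> C * Suc r + 1"
        proof -
          have "card K \<le> (\<Sum>x\<in>\<K>. card (case x of (a, vs) \<Rightarrow> set (chain_points g a vs)))"
            unfolding K_def by (rule card_UN_le[OF fin(1)])
          also have "\<dots> \<le> (\<Sum>x\<in>\<K>. Suc r)"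
          proof (rule sum_mono)
            fix x assume "x \<in> \<K>"
            then show "card (case x of (a, vs) \<Rightarrow> set (chain_points g a vs)) \<le> Suc r"
              using \<K> by (cases x) (metis card_length case_prod_conv length_chain_points)
          qed
          also have "\<dots> \<le> C * Suc r"
            using fin unfolding sum_constant by (simp only: of_nat_id mult_le_mono1)
          finally show ?thesis by simp
        qed
        moreover have "\<exists>b \<in> K. \<exists>u \<in> subsums H hs. \<forall>f \<in> F. \<chi> (f u \<otimes> b) = \<chi> b"
          if \<chi>: "\<chi> \<in> carrier G \<rightarrow> {..<r}" for \<chi>
        proof -
          obtain a vs where av: "(a, vs) \<in> \<K>" and c: "chain H F0 g \<chi> a vs"
            using ch[OF \<chi>] by blast
          note ac = \<K>[OF av]
          have "\<chi> ` set (chain_points g a vs) \<subseteq> {..<r}"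
            using \<chi> chain_points_closed[OF gc] ac by blast
          then have "card (set (map \<chi> (chain_points g a vs))) \<le> r"
            using card_mono[OF finite_lessThan] by fastforce
          then have "\<not> distinct (map \<chi> (chain_points g a vs))"
            using distinct_card[of "map \<chi> (chain_points g a vs)"] ac by fastforce
          from chain_pigeonhole[OF F0(2) _ _ H c this] ac
          obtain p u where "p \<in> set (chain_points g a vs)" "u \<in> subsums H vs"
            "\<forall>f \<in> F. \<chi> (f u \<otimes> p) = \<chi> p"
            using F0(5) by blast
          moreover from this have "p \<in> K" "u \<in> subsums H hs"
            using av ac hs' by (auto simp: K_def)
          ultimately show ?thesis by blast
        qed
        ultimately show ?thesis by blast
      qed
    qed
    then show "\<exists>N C. recurrent_bound H G (Pow (hom H G)) (\<lambda>x. x) (Suc l) r N C"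
      by blast
  qed
qed

end

section \<open>Polynomial maps\<close>

lemma (in comm_group) comm_semigroup: "comm_semigroup G"
  by unfold_locales (auto simp: m_ac)

text \<open>An exact degree, as in \<open>poly_degree\<close>, can drop when maps are subtracted.
  The upper bound is stable and recurses directly.\<close>

fun poly_degree_le ::
  "('h, 'x) monoid_scheme \<Rightarrow> ('a, 'y) monoid_scheme \<Rightarrow> nat \<Rightarrow> ('h \<Rightarrow> 'a) \<Rightarrow> bool" where
  "poly_degree_le H G 0 f \<longleftrightarrow> (\<exists>a \<in> carrier G. \<forall>x \<in> carrier H. f x = a)"
| "poly_degree_le H G (Suc d) f \<longleftrightarrow>
     (\<forall>h \<in> carrier H. poly_degree_le H G d (\<lambda>x. f (x \<otimes>\<^bsub>H\<^esub> h) \<otimes>\<^bsub>G\<^esub> inv\<^bsub>G\<^esub> f x))"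

definition fdiff :: "('a, 'y) monoid_scheme \<Rightarrow> ('h \<Rightarrow> 'a) \<Rightarrow> ('h \<Rightarrow> 'a) \<Rightarrow> 'h \<Rightarrow> 'a" where
  "fdiff G f g = (\<lambda>x. f x \<otimes>\<^bsub>G\<^esub> inv\<^bsub>G\<^esub> g x)"

text \<open>The increment of \<open>f\<close> from \<open>u\<close>. Unlike a plain translate it is
  again zero at the identity, so it stays in \<open>polys_le\<close>.\<close>

definition shift ::
  "('h, 'x) monoid_scheme \<Rightarrow> ('a, 'y) monoid_scheme \<Rightarrow> 'h \<Rightarrow> ('h \<Rightarrow> 'a) \<Rightarrow> 'h \<Rightarrow> 'a" where
  "shift H G u f = (\<lambda>x. f (u \<otimes>\<^bsub>H\<^esub> x) \<otimes>\<^bsub>G\<^esub> inv\<^bsub>G\<^esub> f u)"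

definition polys_le ::
  "('h, 'x) monoid_scheme \<Rightarrow> ('a, 'y) monoid_scheme \<Rightarrow> nat \<Rightarrow> ('h \<Rightarrow> 'a) set" where
  "polys_le H G d = {f \<in> carrier H \<rightarrow> carrier G. poly_degree_le H G d f \<and> f \<one>\<^bsub>H\<^esub> = \<one>\<^bsub>G\<^esub>}"

text \<open>The weight of a family lists, from the top degree downwards, how many classes modulo lower degree are
  needed to cover its members of each degree; PET induction is on the lexicographic order of weights.\<close>

fun covered ::
  "('h, 'x) monoid_scheme \<Rightarrow> ('a, 'y) monoid_scheme \<Rightarrow> nat list \<Rightarrow> ('h \<Rightarrow> 'a) set \<Rightarrow> bool" where
  "covered H G [] F \<longleftrightarrow> F \<subseteq> polys_le H G 0"
| "covered H G (w # ws) F \<longleftrightarrow> F \<subseteq> polys_le H G (Suc (length ws)) \<and>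
     (\<exists>S \<subseteq> polys_le H G (Suc (length ws)). finite S \<and> card S \<le> w \<and>
        covered H G ws {f \<in> F. \<forall>s \<in> S. fdiff G f s \<notin> polys_le H G (length ws)})"

locale comm_group_pair = G?: comm_group G + H: comm_group H for G (structure) and H (structure)
begin

abbreviation "deg_le \<equiv> poly_degree_le H G"
abbreviation "P \<equiv> polys_le H G"

lemma deg_le_cong:
  assumes "\<And>x. x \<in> carrier H \<Longrightarrow> f x = g x"
  shows "deg_le d f \<longleftrightarrow> deg_le d g"
  using assms
proof (induction d arbitrary: f g)
  case (Suc d)
  have "deg_le d (\<lambda>x. f (x \<otimes>\<^bsub>H\<^esub> h) \<otimes> inv f x) \<longleftrightarrow> deg_le d (\<lambda>x. g (x \<otimes>\<^bsub>H\<^esub> h) \<otimes> inv g x)"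
    if "h \<in> carrier H" for h
    using Suc.prems that by (intro Suc.IH) simp
  then show ?case by simp
qed simp

lemma deg_le_eqI:
  assumes "deg_le d f" "\<And>x. x \<in> carrier H \<Longrightarrow> g x = f x"
  shows "deg_le d g"
  using deg_le_cong[of g f d] assms by blast

lemma deg_le_Suc: "\<lbrakk>deg_le d f; f \<in> carrier H \<rightarrow> carrier G\<rbrakk> \<Longrightarrow> deg_le (Suc d) f"
proof (induction d arbitrary: f)
  case 0
  then obtain a where "a \<in> carrier G" "\<forall>x \<in> carrier H. f x = a" by auto
  then show ?case by auto
next
  case (Suc d)
  have "deg_le (Suc d) (\<lambda>x. f (x \<otimes>\<^bsub>H\<^esub> h) \<otimes> inv f x)" if "h \<in> carrier H" for h
  proof (rule Suc.IH)
    show "deg_le d (\<lambda>x. f (x \<otimes>\<^bsub>H\<^esub> h) \<otimes> inv f x)"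
      using Suc.prems(1) that by simp
    show "(\<lambda>x. f (x \<otimes>\<^bsub>H\<^esub> h) \<otimes> inv f x) \<in> carrier H \<rightarrow> carrier G"
      using Suc.prems(2) that by (intro funcsetI m_closed inv_closed) auto
  qed
  then show ?case
    by (simp only: poly_degree_le.simps(2)[of H G "Suc d"]) blast
qed

lemma deg_le_mono:
  assumes "deg_le d f" "f \<in> carrier H \<rightarrow> carrier G" "d \<le> e"
  shows "deg_le e f"
  using assms(3,1) by (induction e rule: dec_induct) (auto simp only: deg_le_Suc assms(2))

lemma deg_le_const: "a \<in> carrier G \<Longrightarrow> deg_le d (\<lambda>x. a)"
  using deg_le_mono[of 0 "\<lambda>x. a" d] by auto

lemma div_mult_div:
  assumes "a \<in> carrier G" "b \<in> carrier G" "c \<in> carrier G" "d \<in> carrier G"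
  shows "(a \<otimes> inv b) \<otimes> inv (c \<otimes> inv d) = (a \<otimes> inv c) \<otimes> inv (b \<otimes> inv d)"
  using assms by (simp add: inv_mult m_ac)

lemma deg_le_diff:
  assumes "deg_le d f" "deg_le d g" "f \<in> carrier H \<rightarrow> carrier G" "g \<in> carrier H \<rightarrow> carrier G"
  shows "deg_le d (fdiff G f g)"
  using assms
proof (induction d arbitrary: f g)
  case 0
  then obtain a b where "a \<in> carrier G" "\<forall>x \<in> carrier H. f x = a" "b \<in> carrier G" "\<forall>x \<in> carrier H. g x = b"
    by auto
  then show ?case
    by (auto simp: fdiff_def intro!: bexI[of _ "a \<otimes> inv b"])
next
  case (Suc d)
  have "deg_le d (\<lambda>x. fdiff G f g (x \<otimes>\<^bsub>H\<^esub> h) \<otimes> inv fdiff G f g x)" if h: "h \<in> carrier H" for h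
  proof -
    have "deg_le d (fdiff G (\<lambda>x. f (x \<otimes>\<^bsub>H\<^esub> h) \<otimes> inv f x) (\<lambda>x. g (x \<otimes>\<^bsub>H\<^esub> h) \<otimes> inv g x))"
      using Suc.prems h by (intro Suc.IH) (auto simp: Pi_iff)
    moreover have "fdiff G f g (x \<otimes>\<^bsub>H\<^esub> h) \<otimes> inv fdiff G f g x =
        fdiff G (\<lambda>x. f (x \<otimes>\<^bsub>H\<^esub> h) \<otimes> inv f x) (\<lambda>x. g (x \<otimes>\<^bsub>H\<^esub> h) \<otimes> inv g x) x"
      if "x \<in> carrier H" for x
      using that h Suc.prems(3,4) unfolding fdiff_def by (intro div_mult_div) auto
    ultimately show ?thesis
      by (rule deg_le_eqI)
  qed
  then show ?case by simp
qed

lemma deg_le_translate: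
  assumes "deg_le d f" "u \<in> carrier H"
  shows "deg_le d (\<lambda>x. f (u \<otimes>\<^bsub>H\<^esub> x))"
  using assms(1)
proof (induction d arbitrary: f)
  case 0
  then show ?case using assms(2) by auto
next
  case (Suc d)
  have "deg_le d (\<lambda>x. f (u \<otimes>\<^bsub>H\<^esub> (x \<otimes>\<^bsub>H\<^esub> h)) \<otimes> inv f (u \<otimes>\<^bsub>H\<^esub> x))" if h: "h \<in> carrier H" for h
  proof -
    have "deg_le d (\<lambda>x. f (u \<otimes>\<^bsub>H\<^esub> x \<otimes>\<^bsub>H\<^esub> h) \<otimes> inv f (u \<otimes>\<^bsub>H\<^esub> x))"
      using Suc.IH[of "\<lambda>x. f (x \<otimes>\<^bsub>H\<^esub> h) \<otimes> inv f x"] Suc.prems h by simp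
    then show ?thesis
      by (rule deg_le_eqI) (use assms(2) h in \<open>simp add: H.m_assoc\<close>)
  qed
  then show ?case by simp
qed

lemma P_closed: "\<lbrakk>f \<in> P d; x \<in> carrier H\<rbrakk> \<Longrightarrow> f x \<in> carrier G"
  by (auto simp: polys_le_def)

lemma P_mono: "d \<le> e \<Longrightarrow> P d \<subseteq> P e"
  using deg_le_mono by (auto simp: polys_le_def)

lemma P_cong:
  assumes "f \<in> P d" "\<And>x. x \<in> carrier H \<Longrightarrow> g x = f x"
  shows "g \<in> P d"
  using assms deg_le_eqI[of d f g] by (auto simp: polys_le_def)

lemma P_0: "f \<in> P 0 \<Longrightarrow> x \<in> carrier H \<Longrightarrow> f x = \<one>"
  unfolding polys_le_def by auto

lemma P_one: "(\<lambda>x. \<one>) \<in> P d"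
  using deg_le_const by (auto simp: polys_le_def)

lemma P_diff: "\<lbrakk>f \<in> P d; g \<in> P d\<rbrakk> \<Longrightarrow> fdiff G f g \<in> P d"
  using deg_le_diff[of d f g] by (auto simp: polys_le_def fdiff_def Pi_iff)

lemma P_mult:
  assumes "f \<in> P d" "g \<in> P d"
  shows "(\<lambda>x. f x \<otimes> g x) \<in> P d"
proof -
  have "fdiff G f (fdiff G (\<lambda>x. \<one>) g) \<in> P d"
    using assms P_one by (intro P_diff)
  then show ?thesis
    by (rule P_cong) (use assms in \<open>simp add: fdiff_def P_closed\<close>)
qed

lemma P_shift:
  assumes "f \<in> P d" "u \<in> carrier H"
  shows "shift H G u f \<in> P d"
proof -
  have f: "f \<in> carrier H \<rightarrow> carrier G" "f u \<in> carrier G"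
    using assms by (auto simp: polys_le_def)
  have "deg_le d (fdiff G (\<lambda>x. f (u \<otimes>\<^bsub>H\<^esub> x)) (\<lambda>x. f u))"
  proof (rule deg_le_diff[OF deg_le_translate deg_le_const])
    show "deg_le d f"
      using assms by (simp add: polys_le_def)
  qed (use assms f in auto)
  then show ?thesis
    using f assms by (auto simp: polys_le_def fdiff_def shift_def Pi_iff)
qed

text \<open>The map is f(x + u) - f(x) - f(u), a first difference of \<open>f\<close> minus a
  constant. This is what makes PET induction work: shifting does not leave the class modulo lower
  degree.\<close>

lemma P_shift_diff:
  assumes "f \<in> P (Suc d)" "u \<in> carrier H"
  shows "fdiff G (shift H G u f) f \<in> P d"
proof -
  have f: "f \<in> carrier H \<rightarrow> carrier G" "f u \<in> carrier G" and "deg_le (Suc d) f" "f \<one>\<^bsub>H\<^esub> = \<one>"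
    using assms by (auto simp: polys_le_def)
  then have "deg_le d (fdiff G (\<lambda>x. f (x \<otimes>\<^bsub>H\<^esub> u) \<otimes> inv f x) (\<lambda>x. f u))"
    using assms by (intro deg_le_diff[OF _ deg_le_const]) (auto simp: Pi_iff)
  moreover have "fdiff G (shift H G u f) f x = fdiff G (\<lambda>x. f (x \<otimes>\<^bsub>H\<^esub> u) \<otimes> inv f x) (\<lambda>x. f u) x"
    if "x \<in> carrier H" for x
    using that f assms(2) by (simp add: fdiff_def shift_def Pi_iff H.m_comm m_ac)
  ultimately have "deg_le d (fdiff G (shift H G u f) f)"
    by (rule deg_le_eqI)
  then show ?thesis
    using f assms P_shift[OF assms] by (auto simp: polys_le_def fdiff_def Pi_iff)
qed

lemma P_hom:
  assumes "f \<in> hom H G"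
  shows "f \<in> P (Suc d)"
proof -
  have cl: "f x \<in> carrier G" if "x \<in> carrier H" for x
    using assms that by (auto simp: hom_def)
  have "f (x \<otimes>\<^bsub>H\<^esub> h) \<otimes> inv f x = f h" if "h \<in> carrier H" "x \<in> carrier H" for h x
    using assms that cl by (simp add: hom_mult m_ac)
  then have "deg_le (Suc 0) f"
    using cl by auto
  then have "f \<in> P (Suc 0)"
    using cl hom_one[OF assms] by (auto simp: polys_le_def)
  then show ?thesis
    using P_mono[of "Suc 0" "Suc d"] by auto
qed

text \<open>The induction is strong because the differences for distinct \<open>h\<close> may have
  distinct exact degrees.\<close>

lemma poly_degree_imp_le:
  assumes "poly_degree H G d f" "f \<in> carrier H \<rightarrow> carrier G"
  shows "deg_le d f"
  using assms
proof (induction d arbitrary: f rule: less_induct)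
  case (less d)
  show ?case
  proof (cases d)
    case (Suc e)
    have "deg_le e (\<lambda>x. f (x \<otimes>\<^bsub>H\<^esub> h) \<otimes> inv f x)" if h: "h \<in> carrier H" for h
    proof -
      have cl: "(\<lambda>x. f (x \<otimes>\<^bsub>H\<^esub> h) \<otimes> inv f x) \<in> carrier H \<rightarrow> carrier G"
        using less.prems(2) h by (auto simp: Pi_iff)
      obtain i where "i \<le> e" "poly_degree H G i (\<lambda>x. f (x \<otimes>\<^bsub>H\<^esub> h) \<otimes> inv f x)"
        using less.prems(1) h Suc by auto
      then show ?thesis
        using less.IH[OF _ _ cl, of i] deg_le_mono[OF _ cl] Suc by auto
    qed
    then show ?thesis by (simp add: Suc)
  qed (use less in simp)
qed

lemma poly_maps_subset: "poly_maps H G \<subseteq> (\<Union>d. P d)"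
  using poly_degree_imp_le by (fastforce simp: poly_maps_def polys_le_def)

section \<open>Weights and the PET step\<close>

lemma covered_imp_P: "covered H G w F \<Longrightarrow> F \<subseteq> P (length w)"
  by (cases w) auto

lemma covered_subset: "\<lbrakk>covered H G w F; F' \<subseteq> F\<rbrakk> \<Longrightarrow> covered H G w F'"
proof (induction w arbitrary: F F')
  case (Cons a w)
  then obtain S where S: "S \<subseteq> P (Suc (length w))" "finite S" "card S \<le> a"
    "covered H G w {f \<in> F. \<forall>s \<in> S. fdiff G f s \<notin> P (length w)}" "F \<subseteq> P (Suc (length w))"
    by auto
  have "covered H G w {f \<in> F'. \<forall>s \<in> S. fdiff G f s \<notin> P (length w)}"
    by (rule Cons.IH[OF S(4)]) (use Cons.prems in auto)
  then show ?case
    using S Cons.prems(2) by auto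
qed auto

lemma covered_empty: "covered H G w {}"
proof (induction w)
  case (Cons a w)
  then show ?case by (auto intro!: exI[of _ "{}"])
qed auto

lemma covered_zeros: "covered H G (replicate n 0) F \<Longrightarrow> F \<subseteq> P 0"
proof (induction n arbitrary: F)
  case (Suc n)
  then obtain S where "S = {}" "covered H G (replicate n 0) {f \<in> F. \<forall>s \<in> S. fdiff G f s \<notin> P n}"
    by auto
  then show ?case
    using Suc.IH by simp
qed simp

text \<open>With all of \<open>F\<close> as representatives in the top degree, each member lies in
  its own class and nothing is left for lower degrees. The weight depends only on size and degree,
  the source of all uniform bounds for polynomial maps.\<close>

lemma covered_finite:
  assumes "finite F" "card F \<le> c" "F \<subseteq> P i"
  shows "covered H G (replicate i c) F"
proof (cases i)
  case (Suc j)
  have "{f \<in> F. \<forall>s \<in> F. fdiff G f s \<notin> P j} = {}"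
  proof -
    have "fdiff G f f \<in> P j" if "f \<in> F" for f
      using P_one by (rule P_cong) (use that assms(3) in \<open>auto simp: fdiff_def intro!: r_inv P_closed\<close>)
    then show ?thesis by blast
  qed
  then have "covered H G (replicate j c) {f \<in> F. \<forall>s \<in> F. fdiff G f s \<notin> P j}"
    using covered_empty by metis
  then show ?thesis
    using assms Suc unfolding Suc replicate_Suc covered.simps length_replicate by blast
qed (use assms in auto)

text \<open>The two copies of \<open>g\<close> cancel and leave (shift of f minus f) + (f - s), both
  of degree at most \<open>d\<close>. So shifting and subtracting \<open>g\<close> carries the class
  of \<open>s\<close> to the class of \<open>s - g\<close>.\<close>

lemma fdiff_shift_mem:
  assumes f: "f \<in> P (Suc d)" and u: "u \<in> carrier H" and s: "s \<in> P (Suc d)" and fs: "fdiff G f s \<in> P d"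
    and g: "g \<in> P (Suc d)"
  shows "fdiff G (fdiff G (shift H G u f) g) (fdiff G s g) \<in> P d"
proof -
  have "(\<lambda>x. fdiff G (shift H G u f) f x \<otimes> fdiff G f s x) \<in> P d"
    by (rule P_mult[OF P_shift_diff[OF f u] fs])
  then show ?thesis
  proof (rule P_cong)
    fix x assume x: "x \<in> carrier H"
    have c: "shift H G u f x \<in> carrier G" "f x \<in> carrier G" "s x \<in> carrier G" "g x \<in> carrier G"
      using P_closed[OF P_shift[OF f u] x] P_closed[OF f x] P_closed[OF s x] P_closed[OF g x] by auto
    have "fdiff G (fdiff G (shift H G u f) g) (fdiff G s g) x =
        (shift H G u f x \<otimes> inv s x) \<otimes> (inv g x \<otimes> g x)"
      using c by (simp only: fdiff_def inv_mult inv_closed m_closed inv_inv m_ac)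
    also have "\<dots> = (shift H G u f x \<otimes> inv s x) \<otimes> (inv f x \<otimes> f x)"
      using c by simp
    also have "\<dots> = fdiff G (shift H G u f) f x \<otimes> fdiff G f s x"
      using c by (simp only: fdiff_def inv_mult inv_closed m_closed inv_inv m_ac)
    finally show "fdiff G (fdiff G (shift H G u f) g) (fdiff G s g) x =
        fdiff G (shift H G u f) f x \<otimes> fdiff G f s x" .
  qed
qed

end

context comm_group_pair
begin

text \<open>Subtracting a representative \<open>g\<close> of a class of least degree removes that class. Translating by
  \<open>U\<close> changes members only by terms of lower degree, so the classes of higher degree stay as they
  are and only those below the degree of \<open>g\<close> multiply.\<close>

lemma covered_step:
  assumes "covered H G (pre @ Suc k # replicate i 0) F" "F \<inter> P 0 = {}" "finite F"
  shows "\<exists>g \<in> P (Suc i). \<forall>U c. finite U \<and> U \<subseteq> carrier H \<and> card F * card U \<le> c \<longrightarrow>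
    covered H G (pre @ k # replicate i c) ((\<lambda>(f, u). fdiff G (shift H G u f) g) ` (F \<times> U))"
  using assms
proof (induction pre arbitrary: F)
  case Nil
  then obtain S where S: "S \<subseteq> P (Suc i)" "finite S" "card S \<le> Suc k" and FP: "F \<subseteq> P (Suc i)"
    and R: "covered H G (replicate i 0) {f \<in> F. \<forall>s \<in> S. fdiff G f s \<notin> P i}"
    by auto
  \<comment> \<open>The weights below are all zero, so whatever \<open>S\<close> misses lies in
    \<open>P 0\<close>, which \<open>F\<close> avoids.\<close>
  have S_ex: "\<exists>s \<in> S. fdiff G f s \<in> P i" if "f \<in> F" for f
    using covered_zeros[OF R] Nil.prems(2) that by blast
  show ?case
  proof (cases "S = {}")
    case True
    then have "F = {}"
      using S_ex by blast
    then show ?thesis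
      using covered_empty P_one by auto
  next
    case False
    then obtain g where g: "g \<in> S" by blast
    then have gP: "g \<in> P (Suc i)"
      using S by blast
    have "covered H G (k # replicate i c) ((\<lambda>(f, u). fdiff G (shift H G u f) g) ` (F \<times> U))"
      if U: "finite U" "U \<subseteq> carrier H" "card F * card U \<le> c" for U c
    proof -
      define D where "D = (\<lambda>(f, u). fdiff G (shift H G u f) g) ` (F \<times> U)"
      \<comment> \<open>The class of \<open>s\<close> becomes that of \<open>s - g\<close>. For
        \<open>s = g\<close> this is the class of the maps of degree at most \<open>i\<close>, which
        are left to the later weights: one representative is saved.\<close>
      define S' where "S' = (\<lambda>s. fdiff G s g) ` (S - {g})"
      define R' where "R' = {q \<in> D. \<forall>s \<in> S'. fdiff G q s \<notin> P i}"
      have DP: "D \<subseteq> P (Suc i)"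
        using FP U gP by (auto simp: D_def intro!: P_diff P_shift)
      have S'P: "S' \<subseteq> P (Suc i)" "finite S'"
        using S gP P_diff by (auto simp: S'_def)
      have "card S' \<le> card (S - {g})"
        unfolding S'_def using S by (intro card_image_le) auto
      then have S'k: "card S' \<le> k"
        using S g by auto
      have finD: "finite D" "card D \<le> c"
        using card_image_prod_le[of F U "card F" "card U"] Nil.prems(3) U
        by (auto simp: D_def intro: order_trans)
      \<comment> \<open>A remaining map comes from the class of \<open>g\<close>, and subtracting
        \<open>g\<close> has lowered its degree to \<open>i\<close>. Only a bound \<open>c\<close>
        on the number of such maps is known, hence the entries \<open>c\<close>.\<close>
      have "R' \<subseteq> P i"
      proof
        fix q assume q: "q \<in> R'"
        then obtain f u where fu: "f \<in> F" "u \<in> U" "q = fdiff G (shift H G u f) g"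
          by (auto simp: R'_def D_def)
        then have f: "f \<in> P (Suc i)" and u: "u \<in> carrier H"
          using FP U by auto
        obtain s where s: "s \<in> S" "fdiff G f s \<in> P i"
          using S_ex fu by blast
        have *: "fdiff G q (fdiff G s g) \<in> P i"
          unfolding fu(3) using s S f u gP by (intro fdiff_shift_mem) auto
        have "s = g"
        proof (rule ccontr)
          assume "s \<noteq> g"
          then have "fdiff G s g \<in> S'"
            using s by (auto simp: S'_def)
          then show False
            using * q by (auto simp: R'_def)
        qed
        have "q \<in> P (Suc i)"
          using q DP by (auto simp: R'_def)
        show "q \<in> P i"
        proof (rule P_cong[OF *])
          fix x assume "x \<in> carrier H"
          then have "q x \<in> carrier G" "g x \<in> carrier G"
            using P_closed \<open>q \<in> P (Suc i)\<close> gP by blast+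
          then show "q x = fdiff G q (fdiff G s g) x"
            using \<open>s = g\<close> by (simp add: fdiff_def)
        qed
      qed
      moreover have "card R' \<le> c" "finite R'"
        using finD card_mono[of D R'] by (auto simp: R'_def)
      ultimately have "covered H G (replicate i c) R'"
        by (intro covered_finite)
      then have "covered H G (k # replicate i c) D"
        unfolding covered.simps(2) length_replicate R'_def using DP S'P S'k by blast
      then show ?thesis by (simp add: D_def)
    qed
    then have "\<forall>U c. finite U \<and> U \<subseteq> carrier H \<and> card F * card U \<le> c \<longrightarrow>
      covered H G ([] @ k # replicate i c) ((\<lambda>(f, u). fdiff G (shift H G u f) g) ` (F \<times> U))"
      unfolding append_Nil by blast
    with gP show ?thesis by blast
  qed
next
  case (Cons w pre)
  define n where "n = length pre + Suc i"
  obtain S where S: "S \<subseteq> P (Suc n)" "finite S" "card S \<le> w" and FP: "F \<subseteq> P (Suc n)"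
    and R: "covered H G (pre @ Suc k # replicate i 0) {f \<in> F. \<forall>s \<in> S. fdiff G f s \<notin> P n}"
    using Cons.prems(1) by (auto simp: n_def)
  define R where "R = {f \<in> F. \<forall>s \<in> S. fdiff G f s \<notin> P n}"
  have RF: "R \<subseteq> F" "finite R" "R \<inter> P 0 = {}"
    using Cons.prems by (auto simp: R_def)
  have "covered H G (pre @ Suc k # replicate i 0) R"
    using R by (simp only: R_def)
  from Cons.IH[OF this RF(3,2)] obtain g where g: "g \<in> P (Suc i)" and
    IH: "\<forall>U c. finite U \<and> U \<subseteq> carrier H \<and> card R * card U \<le> c \<longrightarrow>
      covered H G (pre @ k # replicate i c) ((\<lambda>(f, u). fdiff G (shift H G u f) g) ` (R \<times> U))"
    by (elim bexE)
  \<comment> \<open>\<open>g\<close> has lower degree than the classes counted by \<open>w\<close>.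
    Subtracting it does not move them, so the same \<open>S\<close> serves again.\<close>
  have gn: "g \<in> P n" "g \<in> P (Suc n)"
    using g P_mono[of "Suc i" n] P_mono[of "Suc i" "Suc n"] by (auto simp: n_def)
  have "covered H G (w # pre @ k # replicate i c) ((\<lambda>(f, u). fdiff G (shift H G u f) g) ` (F \<times> U))"
    if U: "finite U" "U \<subseteq> carrier H" "card F * card U \<le> c" for U c
  proof -
    define D where "D = (\<lambda>(f, u). fdiff G (shift H G u f) g) ` (F \<times> U)"
    have DP: "D \<subseteq> P (Suc n)"
      using FP U gn by (auto simp: D_def intro!: P_diff P_shift)
    have "{q \<in> D. \<forall>s \<in> S. fdiff G q s \<notin> P n} \<subseteq> (\<lambda>(f, u). fdiff G (shift H G u f) g) ` (R \<times> U)"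
    proof
      fix q assume q: "q \<in> {q \<in> D. \<forall>s \<in> S. fdiff G q s \<notin> P n}"
      then obtain f u where fu: "f \<in> F" "u \<in> U" "q = fdiff G (shift H G u f) g"
        by (auto simp: D_def)
      have f: "f \<in> P (Suc n)" and u: "u \<in> carrier H"
        using fu FP U by auto
      have "f \<in> R"
      proof (rule ccontr)
        assume "f \<notin> R"
        then obtain s where s: "s \<in> S" "fdiff G f s \<in> P n"
          using fu by (auto simp: R_def)
        then have sP: "s \<in> P (Suc n)"
          using S by auto
        have "fdiff G (fdiff G q (fdiff G s g)) g \<in> P n"
          unfolding fu(3) using s sP f u gn by (intro P_diff[OF fdiff_shift_mem]) auto
        then have "fdiff G q s \<in> P n"
        proof (rule P_cong)
          fix x assume x: "x \<in> carrier H"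
          have c: "q x \<in> carrier G" "s x \<in> carrier G" "g x \<in> carrier G"
            using P_closed[OF _ x] q DP sP gn by blast+
          have "fdiff G (fdiff G q (fdiff G s g)) g x = (q x \<otimes> inv s x) \<otimes> (g x \<otimes> inv g x)"
            using c by (simp only: fdiff_def inv_mult inv_closed m_closed inv_inv m_ac)
          then show "fdiff G q s x = fdiff G (fdiff G q (fdiff G s g)) g x"
            using c by (simp add: fdiff_def)
        qed
        then show False
          using q s by blast
      qed
      then show "q \<in> (\<lambda>(f, u). fdiff G (shift H G u f) g) ` (R \<times> U)"
        using fu by auto
    qed
    moreover have "card R * card U \<le> c"
      using card_mono[OF Cons.prems(3) RF(1)] U(3) by (meson mult_le_mono1 order_trans)
    ultimately have "covered H G (pre @ k # replicate i c) {q \<in> D. \<forall>s \<in> S. fdiff G q s \<notin> P n}"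
      using IH U(1,2) by (intro covered_subset[OF IH[rule_format, of U c]]) simp_all
    moreover have "length (pre @ k # replicate i c) = n"
      by (simp add: n_def)
    ultimately show ?thesis
      unfolding D_def[symmetric] covered.simps using DP S by auto
  qed
  then have "\<forall>U c. finite U \<and> U \<subseteq> carrier H \<and> card F * card U \<le> c \<longrightarrow>
      covered H G ((w # pre) @ k # replicate i c) ((\<lambda>(f, u). fdiff G (shift H G u f) g) ` (F \<times> U))"
    unfolding append_Cons by blast
  with g show ?case by blast
qed

section \<open>Colour focusing and the induction on weights\<close>

lemma nat_list_cases:
  fixes w :: "nat list"
  obtains "w = replicate (length w) 0" | pre k i where "w = pre @ Suc k # replicate i 0"
proof -
  have "w = replicate (length w) 0 \<or> (\<exists>pre k i. w = pre @ Suc k # replicate i 0)"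
  proof (induction w)
    case (Cons a w)
    then show ?case
    proof (elim disjE exE)
      assume w: "w = replicate (length w) 0"
      show ?thesis
      proof (cases a)
        case 0
        then show ?thesis using w by simp
      next
        case (Suc k)
        then have "a # w = [] @ Suc k # replicate (length w) 0"
          using w by simp
        then show ?thesis by blast
      qed
    next
      fix pre k i
      assume "w = pre @ Suc k # replicate i 0"
      then have "a # w = (a # pre) @ Suc k # replicate i 0"
        by simp
      then show ?thesis by blast
    qed
  qed simp
  then show thesis
    using that by blast
qed

text \<open>\<open>E\<close> is the set of colours of the families focused at \<open>a\<close>. With \<open>k = r\<close> no colour is left for
  \<open>a\<close> itself, so the first alternative must hold.\<close>

definition focus_bound :: "nat list \<Rightarrow> nat \<Rightarrow> nat \<Rightarrow> nat \<Rightarrow> nat \<Rightarrow> nat \<Rightarrow> bool" where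
  "focus_bound w l r k N C \<longleftrightarrow>
     (\<forall>F hs. covered H G w F \<and> F \<inter> P 0 = {} \<and> finite F \<and> card F \<le> l \<and>
         set hs \<subseteq> carrier H \<and> length hs = N \<longrightarrow>
       (\<exists>K. K \<subseteq> carrier G \<and> finite K \<and> card K \<le> C \<and>
         (\<forall>\<chi> \<in> carrier G \<rightarrow> {..<r}. \<exists>a \<in> K.
            (\<exists>u \<in> subsums H hs. \<forall>f \<in> F. \<chi> (f u \<otimes> a) = \<chi> a) \<or>
            (\<exists>E \<subseteq> {..<r}. card E = k \<and> \<chi> a \<notin> E \<and>
               (\<forall>e \<in> E. \<exists>u \<in> subsums H hs. \<forall>f \<in> F. \<chi> (f u \<otimes> a) = e)))))"

lemma focus_boundD:
  assumes "focus_bound w l r k N C"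
    and "covered H G w F" "F \<inter> P 0 = {}" "finite F" "card F \<le> l" "set hs \<subseteq> carrier H" "length hs = N"
  shows "\<exists>K. K \<subseteq> carrier G \<and> finite K \<and> card K \<le> C \<and>
         (\<forall>\<chi> \<in> carrier G \<rightarrow> {..<r}. \<exists>a \<in> K.
            (\<exists>u \<in> subsums H hs. \<forall>f \<in> F. \<chi> (f u \<otimes> a) = \<chi> a) \<or>
            (\<exists>E \<subseteq> {..<r}. card E = k \<and> \<chi> a \<notin> E \<and>
               (\<forall>e \<in> E. \<exists>u \<in> subsums H hs. \<forall>f \<in> F. \<chi> (f u \<otimes> a) = e)))"
  using assms(1)[unfolded focus_bound_def, rule_format, of F hs] assms(2-) by simp

text \<open>Induction on the number of focused colours. From a focus point \<open>a\<close> for the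
  colouring translated by \<open>b\<close>, the new one is a' = a + b - g(v), and f(u + v) + a' =
  (f(u) + a) + (f(u + v) - f(u) - g(v)) + b. The middle bracket is the value at \<open>v\<close> of
  a map in a family of smaller weight, so \<open>v\<close> can be chosen such that the colour of
  f(u) + a + b is kept. With \<open>u\<close> the identity, f(v) + a' gets the colour of a + b,
  which is the additional focused colour.\<close>

lemma focus_step:
  assumes rec: "\<And>c l. recurrent H G {F. covered H G (pre @ k # replicate i c) F} (\<lambda>x. x) l"
  shows "\<exists>N C. focus_bound (pre @ Suc k # replicate i 0) l r m N C"
proof (induction m)
  case 0
  have "focus_bound (pre @ Suc k # replicate i 0) l r 0 0 1"
    unfolding focus_bound_def by (intro allI impI exI[of _ "{\<one>}"]) auto
  then show ?case by blast
next
  case (Suc m)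
  then obtain N1 C1 where 1: "focus_bound (pre @ Suc k # replicate i 0) l r m N1 C1"
    by blast
  \<comment> \<open>\<open>l'\<close> counts pairs of a function and a shift; the shifts are at most
    \<open>2 ^ N1\<close> sums and the identity. \<open>n\<close> counts the candidates
    \<open>a\<close> and the points \<open>f u \<otimes> a\<close>.\<close>
  define l' where "l' = l * (2 ^ N1 + 1)"
  define n where "n = C1 + C1 * (2 ^ N1 * l)"
  have id: "(\<lambda>x. x) \<in> carrier G \<rightarrow> carrier G" by simp
  note sgH = H.comm_semigroup
  obtain N2 C2 where 2: "shift_recurrent_bound H G {F. covered H G (pre @ k # replicate i l') F}
      (\<lambda>x. x) l' r n N2 C2"
    by (rule comm_semigroup.recurrent_shift[OF G.comm_semigroup rec id sgH])
  have "focus_bound (pre @ Suc k # replicate i 0) l r (Suc m) (N1 + N2) (C1 * (C2 * 2 ^ N2) + C1 * C2)"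
    unfolding focus_bound_def
  proof (intro allI impI; elim conjE)
    fix F and hs :: "'c list"
    assume cov: "covered H G (pre @ Suc k # replicate i 0) F" and F0: "F \<inter> P 0 = {}"
      and finF: "finite F" "card F \<le> l" and hs: "set hs \<subseteq> carrier H" "length hs = N1 + N2"
    define hs1 hs2 where "hs1 = take N1 hs" and "hs2 = drop N1 hs"
    have hs12: "hs = hs1 @ hs2" "length hs1 = N1" "length hs2 = N2"
      using hs by (auto simp: hs1_def hs2_def)
    then have sub: "set hs1 \<subseteq> carrier H" "set hs2 \<subseteq> carrier H"
      using hs by auto
    note cl1 = comm_semigroup.subsums_closed[OF sgH sub(1)]
      and cl2 = comm_semigroup.subsums_closed[OF sgH sub(2)]
    have Fc: "f x \<in> carrier G" if "f \<in> F" "x \<in> carrier H" for f x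
      using covered_imp_P[OF cov] that P_closed by blast
    have f1: "f \<one>\<^bsub>H\<^esub> = \<one>" if "f \<in> F" for f
      using covered_imp_P[OF cov] that by (auto simp: polys_le_def)
    obtain K1 where K1: "K1 \<subseteq> carrier G" "finite K1" "card K1 \<le> C1"
      and foc: "\<forall>\<chi> \<in> carrier G \<rightarrow> {..<r}. \<exists>a \<in> K1.
            (\<exists>u \<in> subsums H hs1. \<forall>f \<in> F. \<chi> (f u \<otimes> a) = \<chi> a) \<or>
            (\<exists>E \<subseteq> {..<r}. card E = m \<and> \<chi> a \<notin> E \<and>
               (\<forall>e \<in> E. \<exists>u \<in> subsums H hs1. \<forall>f \<in> F. \<chi> (f u \<otimes> a) = e))"
      using focus_boundD[OF 1 cov F0 finF sub(1) hs12(2)] by (elim exE conjE) (rule that)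
    \<comment> \<open>Shifting by the identity of \<open>H\<close> puts the maps
      \<open>f - g\<close> themselves into the family; they are needed for \<open>v\<close>
      alone.\<close>
    define U where "U = insert \<one>\<^bsub>H\<^esub> (subsums H hs1)"
    have U: "finite U" "U \<subseteq> carrier H"
      using cl1 by (auto simp: U_def)
    have "card U \<le> 2 ^ N1 + 1"
      using card_subsums[of H hs1] hs12(2) by (simp add: U_def card_insert_if)
    then have FU: "card F * card U \<le> l'"
      unfolding l'_def using finF(2) by (rule mult_le_mono[rotated])
    obtain g where g: "g \<in> P (Suc i)"
      and covD: "covered H G (pre @ k # replicate i l') ((\<lambda>(f, u). fdiff G (shift H G u f) g) ` (F \<times> U))"
      using covered_step[OF cov F0 finF(1)] U FU by meson
    define D where "D = (\<lambda>(f, u). fdiff G (shift H G u f) g) ` (F \<times> U)"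
    have D: "D \<in> {F. covered H G (pre @ k # replicate i l') F}" "D \<subseteq> carrier H \<rightarrow> carrier G"
      using covD covered_imp_P[OF covD] by (auto simp: D_def[symmetric] polys_le_def)
    have finD: "finite D" "card D \<le> l'"
      using card_image_prod_le[of F U "card F" "card U"] finF U FU
      by (auto simp: D_def intro: order_trans)
    have gc: "g x \<in> carrier G" if "x \<in> carrier H" for x
      using g that P_closed by blast
    obtain K2 where K2: "K2 \<subseteq> carrier G" "finite K2" "card K2 \<le> C2"
      and inv2: "\<And>\<chi> Y. \<lbrakk>\<chi> \<in> carrier G \<rightarrow> {..<r}; Y \<subseteq> carrier G; finite Y; card Y \<le> n\<rbrakk> \<Longrightarrow>
      \<exists>b \<in> K2. \<exists>u \<in> subsums H hs2. \<forall>f \<in> D. \<chi> (f u \<otimes> b) = \<chi> b \<and>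
        (\<forall>y \<in> Y. \<chi> (y \<otimes> (f u \<otimes> b)) = \<chi> (y \<otimes> b))"
      using shift_recurrent_boundE[OF 2 D finD sub(2) hs12(3)] by metis
    define Y where "Y = K1 \<union> (\<lambda>(a, (u, f)). f u \<otimes> a) ` (K1 \<times> (subsums H hs1 \<times> F))"
    have Yc: "Y \<subseteq> carrier G"
      using K1(1) cl1 Fc by (auto simp: Y_def intro!: G.m_closed)
    have s1: "finite (subsums H hs1 \<times> F)" "card (subsums H hs1 \<times> F) \<le> 2 ^ N1 * l"
      using finF card_subsums[of H hs1] hs12 by (auto simp: card_cartesian_product intro!: mult_le_mono)
    have Y: "finite Y" "card Y \<le> n"
      using card_image_prod_le[OF K1(2) s1(1) K1(3) s1(2), of "\<lambda>a (u, f). f u \<otimes> a"] K1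
        card_Un_le[of K1 "(\<lambda>(a, (u, f)). f u \<otimes> a) ` (K1 \<times> (subsums H hs1 \<times> F))"]
      by (auto simp: Y_def n_def)
    \<comment> \<open>\<open>L1\<close> contains the new focus points, \<open>L2\<close> the points
      a + b at which the earlier focusing has already succeeded.\<close>
    define L1 where "L1 = (\<lambda>(a, (b, v)). a \<otimes> b \<otimes> inv g v) ` (K1 \<times> (K2 \<times> subsums H hs2))"
    define L2 where "L2 = (\<lambda>(a, b). a \<otimes> b) ` (K1 \<times> K2)"
    have s2: "finite (K2 \<times> subsums H hs2)" "card (K2 \<times> subsums H hs2) \<le> C2 * 2 ^ N2"
      using K2 card_subsums[of H hs2] hs12 by (auto simp: card_cartesian_product intro!: mult_le_mono)
    have L1: "finite L1" "card L1 \<le> C1 * (C2 * 2 ^ N2)"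
      using card_image_prod_le[OF K1(2) s2(1) K1(3) s2(2), of "\<lambda>a (b, v). a \<otimes> b \<otimes> inv g v"]
      by (auto simp: L1_def)
    have L2: "finite L2" "card L2 \<le> C1 * C2"
      using card_image_prod_le[OF K1(2) K2(2) K1(3) K2(3), of "\<lambda>a b. a \<otimes> b"]
      by (auto simp: L2_def)
    have Lc: "L1 \<union> L2 \<subseteq> carrier G"
      using K1(1) K2(1) cl2 gc by (auto simp: L1_def L2_def intro!: G.m_closed G.inv_closed)
    have "\<exists>a \<in> L1 \<union> L2.
            (\<exists>u \<in> subsums H hs. \<forall>f \<in> F. \<chi> (f u \<otimes> a) = \<chi> a) \<or>
            (\<exists>E \<subseteq> {..<r}. card E = Suc m \<and> \<chi> a \<notin> E \<and>
               (\<forall>e \<in> E. \<exists>u \<in> subsums H hs. \<forall>f \<in> F. \<chi> (f u \<otimes> a) = e))"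
      if \<chi>: "\<chi> \<in> carrier G \<rightarrow> {..<r}" for \<chi>
    proof -
      obtain b v where b: "b \<in> K2" and v: "v \<in> subsums H hs2"
        and inv: "\<And>q y. \<lbrakk>q \<in> D; y \<in> Y\<rbrakk> \<Longrightarrow> \<chi> (y \<otimes> (q v \<otimes> b)) = \<chi> (y \<otimes> b)"
        using inv2[OF \<chi> Yc Y] by blast
      have bc: "b \<in> carrier G" and vc: "v \<in> carrier H" and gv: "g v \<in> carrier G"
        using b K2 v cl2 gc by auto
      have "(\<lambda>x. \<chi> (x \<otimes> b)) \<in> carrier G \<rightarrow> {..<r}"
        using \<chi> bc by (auto simp: Pi_iff)
      from bspec[OF foc this] obtain a where a: "a \<in> K1"
        and alt: "(\<exists>u \<in> subsums H hs1. \<forall>f \<in> F. \<chi> (f u \<otimes> a \<otimes> b) = \<chi> (a \<otimes> b)) \<or>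
            (\<exists>E \<subseteq> {..<r}. card E = m \<and> \<chi> (a \<otimes> b) \<notin> E \<and>
               (\<forall>e \<in> E. \<exists>u \<in> subsums H hs1. \<forall>f \<in> F. \<chi> (f u \<otimes> a \<otimes> b) = e))"
        by blast
      have ac: "a \<in> carrier G"
        using a K1 by auto
      have hs_sub: "subsums H hs1 \<subseteq> subsums H hs" "v \<in> subsums H hs"
        "\<And>u. u \<in> subsums H hs1 \<Longrightarrow> u \<otimes>\<^bsub>H\<^esub> v \<in> subsums H hs"
        using comm_semigroup.subsums_append[OF sgH sub] hs12(1) v by auto
      show ?thesis
        using alt
      proof (elim disjE exE conjE)
        assume "\<exists>u \<in> subsums H hs1. \<forall>f \<in> F. \<chi> (f u \<otimes> a \<otimes> b) = \<chi> (a \<otimes> b)"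
        then obtain u where u: "u \<in> subsums H hs1" "\<And>f. f \<in> F \<Longrightarrow> \<chi> (f u \<otimes> a \<otimes> b) = \<chi> (a \<otimes> b)"
          by blast
        moreover have "f u \<otimes> (a \<otimes> b) = f u \<otimes> a \<otimes> b" if "f \<in> F" for f
          using Fc[OF that] cl1 u(1) ac bc by (simp add: G.m_assoc subset_iff)
        ultimately have "\<chi> (f u \<otimes> (a \<otimes> b)) = \<chi> (a \<otimes> b)" if "f \<in> F" for f
          using that by simp
        moreover have "a \<otimes> b \<in> L1 \<union> L2"
          using a b by (auto simp: L2_def)
        ultimately show ?thesis
          using u hs_sub by blast
      next
        fix E
        assume E: "E \<subseteq> {..<r}" "card E = m" "\<chi> (a \<otimes> b) \<notin> E"
          and foc_E: "\<forall>e \<in> E. \<exists>u \<in> subsums H hs1. \<forall>f \<in> F. \<chi> (f u \<otimes> a \<otimes> b) = e"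
        define a' where "a' = a \<otimes> b \<otimes> inv g v"
        have a': "a' \<in> L1 \<union> L2"
          using a b v by (force simp: a'_def L1_def)
        have col1: "\<chi> (f v \<otimes> a') = \<chi> (a \<otimes> b)" if "f \<in> F" for f
        proof -
          have "fdiff G (shift H G \<one>\<^bsub>H\<^esub> f) g \<in> D"
            using that by (auto simp: D_def U_def)
          moreover have "a \<in> Y"
            using a by (simp add: Y_def)
          ultimately have "\<chi> (a \<otimes> (fdiff G (shift H G \<one>\<^bsub>H\<^esub> f) g v \<otimes> b)) = \<chi> (a \<otimes> b)"
            by (rule inv)
          moreover have "fdiff G (shift H G \<one>\<^bsub>H\<^esub> f) g v = f v \<otimes> inv g v"
            using that vc Fc[OF that vc] f1[OF that] by (simp add: fdiff_def shift_def)
          moreover have "a \<otimes> (f v \<otimes> inv g v \<otimes> b) = f v \<otimes> a'"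
            using Fc[OF that vc] ac bc gv by (simp add: a'_def G.m_ac)
          ultimately show ?thesis by simp
        qed
        have col2: "\<chi> (f (u \<otimes>\<^bsub>H\<^esub> v) \<otimes> a') = \<chi> (f u \<otimes> a \<otimes> b)" if "f \<in> F" "u \<in> subsums H hs1" for f u
        proof -
          have uc: "u \<in> carrier H"
            using that cl1 by auto
          have "fdiff G (shift H G u f) g \<in> D"
            using that by (auto simp: D_def U_def)
          moreover have "f u \<otimes> a \<in> Y"
            using a that by (force simp: Y_def)
          ultimately have "\<chi> (f u \<otimes> a \<otimes> (fdiff G (shift H G u f) g v \<otimes> b)) = \<chi> (f u \<otimes> a \<otimes> b)"
            by (rule inv)
          moreover have "f u \<otimes> a \<otimes> (fdiff G (shift H G u f) g v \<otimes> b) = f (u \<otimes>\<^bsub>H\<^esub> v) \<otimes> a'"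
          proof -
            have c: "f u \<in> carrier G" "f (u \<otimes>\<^bsub>H\<^esub> v) \<in> carrier G"
              using Fc that uc vc by auto
            have "f u \<otimes> a \<otimes> (f (u \<otimes>\<^bsub>H\<^esub> v) \<otimes> inv f u \<otimes> inv g v \<otimes> b)
                = (f u \<otimes> inv f u) \<otimes> (f (u \<otimes>\<^bsub>H\<^esub> v) \<otimes> a')"
              using c ac bc gv by (simp only: a'_def G.m_ac G.m_closed G.inv_closed)
            then show ?thesis
              using c ac bc gv by (simp add: fdiff_def shift_def a'_def)
          qed
          ultimately show ?thesis by simp
        qed
        define E' where "E' = insert (\<chi> (a \<otimes> b)) E"
        have E'r: "E' \<subseteq> {..<r}"
          using E(1) \<chi> ac bc by (auto simp: E'_def)
        have "finite E"
          using E(1) finite_subset by blast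
        then have cE': "card E' = Suc m"
          using E by (simp add: E'_def)
        have foc': "\<exists>u \<in> subsums H hs. \<forall>f \<in> F. \<chi> (f u \<otimes> a') = e" if "e \<in> E'" for e
        proof (cases "e = \<chi> (a \<otimes> b)")
          case True
          then show ?thesis
            using col1 hs_sub by blast
        next
          case False
          then have "e \<in> E"
            using that by (simp add: E'_def)
          then obtain u where "u \<in> subsums H hs1" "\<forall>f \<in> F. \<chi> (f u \<otimes> a \<otimes> b) = e"
            using foc_E by blast
          then show ?thesis
            using col2 hs_sub by metis
        qed
        \<comment> \<open>If the focus point itself has a focused colour, the sum belonging to that
          colour solves the problem; otherwise there are \<open>Suc m\<close> focused
          colours.\<close>
        show ?thesis
        proof (cases "\<chi> a' \<in> E'")
          case True
          then show ?thesis
            using foc' a' by blast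
        next
          case False
          then show ?thesis
            using foc' a' E'r cE' by (intro bexI[OF _ a'] disjI2 exI[of _ E'] conjI) auto
        qed
      qed
    qed
    moreover have "finite (L1 \<union> L2)" "card (L1 \<union> L2) \<le> C1 * (C2 * 2 ^ N2) + C1 * C2"
      using L1 L2 card_Un_le[of L1 L2] by auto
    ultimately show "\<exists>K. K \<subseteq> carrier G \<and> finite K \<and> card K \<le> C1 * (C2 * 2 ^ N2) + C1 * C2 \<and>
         (\<forall>\<chi> \<in> carrier G \<rightarrow> {..<r}. \<exists>a \<in> K.
            (\<exists>u \<in> subsums H hs. \<forall>f \<in> F. \<chi> (f u \<otimes> a) = \<chi> a) \<or>
            (\<exists>E \<subseteq> {..<r}. card E = Suc m \<and> \<chi> a \<notin> E \<and>
               (\<forall>e \<in> E. \<exists>u \<in> subsums H hs. \<forall>f \<in> F. \<chi> (f u \<otimes> a) = e)))"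
      using Lc by (intro exI[of _ "L1 \<union> L2"]) simp
  qed
  then show ?case by blast
qed

lemma recurrent_covered: "recurrent H G {F. covered H G w F} (\<lambda>x. x) l"
proof (induction w arbitrary: l rule: wf_induct_rule[OF wf_lex[OF wf_less_than]])
  case (1 w)
  show ?case
  proof (cases w rule: nat_list_cases)
    case 1
    have "recurrent_bound H G {F. covered H G w F} (\<lambda>x. x) l r 1 1" for r
    proof (rule recurrent_boundI)
      fix F :: "('c \<Rightarrow> 'a) set" and hs :: "'c list"
      assume F: "F \<in> {F. covered H G w F}" and hs: "set hs \<subseteq> carrier H" "length hs = 1"
      have FP0: "F \<subseteq> P 0"
        using F 1 covered_zeros by (metis mem_Collect_eq)
      have h0: "hs ! 0 \<in> subsums H hs" "hs ! 0 \<in> carrier H"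
        using hs by (auto simp: length_Suc_conv)
      moreover have "f (hs ! 0) \<otimes> \<one> = \<one>" if "f \<in> F" for f
        using P_0[of f "hs ! 0"] that FP0 h0(2) by auto
      ultimately show "\<exists>K. K \<subseteq> carrier G \<and> finite K \<and> card K \<le> 1 \<and>
        (\<forall>\<chi> \<in> carrier G \<rightarrow> {..<r}. \<exists>b \<in> K. \<exists>u \<in> subsums H hs. \<forall>f \<in> F. \<chi> (f u \<otimes> b) = \<chi> b)"
        by (intro exI[of _ "{\<one>}"] conjI ballI bexI[of _ "\<one>"] bexI[of _ "hs ! 0"]) simp_all
    qed
    then show ?thesis
      unfolding recurrent_def by blast
  next
    case (2 pre k i)
    \<comment> \<open>The entries \<open>c\<close> may be large: the order compares lists of equal
      length at their first difference, where \<open>k\<close> has replaced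
      \<open>Suc k\<close>.\<close>
    have rec: "recurrent H G {F. covered H G (pre @ k # replicate i c) F} (\<lambda>x. x) l" for c l
      by (rule 1) (auto simp: 2 lex_conv intro!: exI[of _ pre])
    show ?thesis
      unfolding recurrent_def
    proof
      fix r
      obtain N C where NC: "focus_bound w l r r N C"
        using focus_step[OF rec] 2 by blast
      have "recurrent_bound H G {F. covered H G w F} (\<lambda>x. x) l r N C"
      proof (rule recurrent_boundI)
        fix F :: "('c \<Rightarrow> 'a) set" and hs :: "'c list"
        assume F: "F \<in> {F. covered H G w F}" "finite F" "card F \<le> l"
          and hs: "set hs \<subseteq> carrier H" "length hs = N"
        \<comment> \<open>Members of \<open>P 0\<close> are zero on the carrier and move no point,
          so they can be set aside; \<open>covered_step\<close> needs them absent.\<close>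
        define F0 where "F0 = F - P 0"
        have F0: "covered H G w F0" "F0 \<inter> P 0 = {}" "finite F0" "card F0 \<le> l"
          using F covered_subset[of w F F0] card_mono[of F F0] by (auto simp: F0_def)
        obtain K where K: "K \<subseteq> carrier G" "finite K" "card K \<le> C"
          and foc: "\<forall>\<chi> \<in> carrier G \<rightarrow> {..<r}. \<exists>a \<in> K.
            (\<exists>u \<in> subsums H hs. \<forall>f \<in> F0. \<chi> (f u \<otimes> a) = \<chi> a) \<or>
            (\<exists>E \<subseteq> {..<r}. card E = r \<and> \<chi> a \<notin> E \<and>
               (\<forall>e \<in> E. \<exists>u \<in> subsums H hs. \<forall>f \<in> F0. \<chi> (f u \<otimes> a) = e))"
          using focus_boundD[OF NC F0 hs] by (elim exE conjE) (rule that)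
        have "\<exists>b \<in> K. \<exists>u \<in> subsums H hs. \<forall>f \<in> F. \<chi> (f u \<otimes> b) = \<chi> b"
          if \<chi>: "\<chi> \<in> carrier G \<rightarrow> {..<r}" for \<chi>
        proof -
          obtain a where a: "a \<in> K" and alt: "(\<exists>u \<in> subsums H hs. \<forall>f \<in> F0. \<chi> (f u \<otimes> a) = \<chi> a) \<or>
            (\<exists>E \<subseteq> {..<r}. card E = r \<and> \<chi> a \<notin> E)"
            using bspec[OF foc \<chi>] by blast
          have ac: "a \<in> carrier G" and "\<chi> a < r"
            using a K \<chi> by auto
          have "E = {..<r}" if "E \<subseteq> {..<r}" "card E = r" for E
            using that by (intro card_subset_eq) auto
          then obtain u where u: "u \<in> subsums H hs" "\<forall>f \<in> F0. \<chi> (f u \<otimes> a) = \<chi> a"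
            using alt \<open>\<chi> a < r\<close> by blast
          have "u \<in> carrier H"
            using u comm_semigroup.subsums_closed[OF H.comm_semigroup hs(1)] by auto
          then have "\<chi> (f u \<otimes> a) = \<chi> a" if "f \<in> F" for f
            using that u(2) ac P_0[of f u] by (cases "f \<in> P 0") (auto simp: F0_def)
          then show ?thesis
            using a u by blast
        qed
        then show "\<exists>K. K \<subseteq> carrier G \<and> finite K \<and> card K \<le> C \<and>
        (\<forall>\<chi> \<in> carrier G \<rightarrow> {..<r}. \<exists>b \<in> K. \<exists>u \<in> subsums H hs. \<forall>f \<in> F. \<chi> (f u \<otimes> b) = \<chi> b)"
          using K by blast
      qed
      then show "\<exists>N C. recurrent_bound H G {F. covered H G w F} (\<lambda>x. x) l r N C"
        by blast
    qed
  qed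
qed

text \<open>The one weight \<open>replicate d l\<close> fits every family of at most
  \<open>l\<close> maps in \<open>P d\<close>, so its constants serve all of them.\<close>

theorem recurrent_polys: "recurrent H G (Pow (P d)) (\<lambda>x. x) l"
  unfolding recurrent_def
proof
  fix r
  obtain N C where NC: "recurrent_bound H G {F. covered H G (replicate d l) F} (\<lambda>x. x) l r N C"
    using recurrent_covered unfolding recurrent_def by blast
  have "recurrent_bound H G (Pow (P d)) (\<lambda>x. x) l r N C"
    unfolding recurrent_bound_def
  proof (intro allI impI; elim conjE)
    fix F :: "('c \<Rightarrow> 'a) set" and hs :: "'c list"
    assume "F \<in> Pow (P d)" "F \<subseteq> carrier H \<rightarrow> carrier G" "finite F" "card F \<le> l"
      "set hs \<subseteq> carrier H" "length hs = N"
    then show "\<exists>K. K \<subseteq> carrier G \<and> finite K \<and> card K \<le> C \<and>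
        (\<forall>\<chi> \<in> carrier G \<rightarrow> {..<r}. \<exists>b \<in> K. \<exists>u \<in> subsums H hs. \<forall>f \<in> F. \<chi> (f u \<otimes> b) = \<chi> b)"
      using NC[unfolded recurrent_bound_def, rule_format, of F hs] covered_finite[of F l d] by simp
  qed
  then show "\<exists>N C. recurrent_bound H G (Pow (P d)) (\<lambda>x. x) l r N C"
    by blast
qed

end

section \<open>Tuples with level-dependent colours\<close>

lemma recurrent_cong:
  assumes "\<And>x. x \<in> carrier G \<Longrightarrow> c x = c' x" "recurrent H G \<FF> c l"
  shows "recurrent H G \<FF> c' l"
proof -
  have "recurrent_bound H G \<FF> c' l r N C" if NC: "recurrent_bound H G \<FF> c l r N C" for r N C
  proof (rule recurrent_boundI)
    fix F :: "('c \<Rightarrow> 'a) set" and hs :: "'c list"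
    assume F: "F \<in> \<FF>" "F \<subseteq> carrier H \<rightarrow> carrier G" "finite F" "card F \<le> l"
      "set hs \<subseteq> carrier H" "length hs = N"
    obtain K where K: "K \<subseteq> carrier G" "finite K" "card K \<le> C"
      and *: "\<And>\<chi>. \<chi> \<in> carrier G \<rightarrow> {..<r} \<Longrightarrow> \<exists>b \<in> K. \<exists>u \<in> subsums H hs. \<forall>f \<in> F.
            \<chi> (f u \<otimes>\<^bsub>G\<^esub> c b) = \<chi> (c b)"
      using recurrent_boundE[OF NC F] by metis
    have "\<exists>b \<in> K. \<exists>u \<in> subsums H hs. \<forall>f \<in> F. \<chi> (f u \<otimes>\<^bsub>G\<^esub> c' b) = \<chi> (c' b)"
      if "\<chi> \<in> carrier G \<rightarrow> {..<r}" for \<chi>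
      using *[OF that] K(1) assms(1) by (metis subsetD)
    then show "\<exists>K. K \<subseteq> carrier G \<and> finite K \<and> card K \<le> C \<and>
        (\<forall>\<chi> \<in> carrier G \<rightarrow> {..<r}. \<exists>b \<in> K. \<exists>u \<in> subsums H hs. \<forall>f \<in> F.
            \<chi> (f u \<otimes>\<^bsub>G\<^esub> c' b) = \<chi> (c' b))"
      using K by blast
  qed
  then show ?thesis
    using assms(2) unfolding recurrent_def by metis
qed

text \<open>Colouring \<open>x\<close> also by its coset modulo the image of \<open>c\<close> keeps all points of a configuration in one
  coset, and a translation moves them into the image.\<close>

lemma (in comm_group) recurrent_finite_index:
  assumes c: "c \<in> hom G G" and fin: "finite (rcosets (c ` carrier G))"
    and H: "comm_semigroup H" and rec: "recurrent H G \<FF> (\<lambda>x. x) l"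
  shows "recurrent H G \<FF> c l"
  unfolding recurrent_def
proof
  fix r
  define I where "I = c ` carrier G"
  interpret c: group_hom G G c
    by unfold_locales (rule c)
  have I: "subgroup I G"
    unfolding I_def by (rule c.img_is_subgroup)
  obtain e where e: "bij_betw e (rcosets I) {0..<card (rcosets I)}"
    using fin ex_bij_betw_finite_nat unfolding I_def by blast
  \<comment> \<open>The choice depends only on the coset, so all points of one coset are translated
    by the same element.\<close>
  define \<rho> where "\<rho> x = (SOME z. z \<in> I #> x)" for x
  have \<rho>: "\<rho> x \<in> I #> x" if "x \<in> carrier G" for x
    unfolding \<rho>_def using rcos_self[OF that I] by (rule someI)
  have \<rho>c: "\<rho> x \<in> carrier G" if "x \<in> carrier G" for x
    using \<rho>[OF that] r_coset_subset_G[OF subgroup.subset[OF I] that] by blast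
  have \<rho>I: "x \<otimes> inv \<rho> x \<in> I" if x: "x \<in> carrier G" for x
  proof -
    obtain h where h: "h \<in> I" "\<rho> x = h \<otimes> x"
      using \<rho>[OF x] by (auto simp: r_coset_def)
    have hc: "h \<in> carrier G"
      using h subgroup.subset[OF I] by blast
    have "x \<otimes> inv \<rho> x = inv h \<otimes> (x \<otimes> inv x)"
      using h hc x by (simp only: inv_mult inv_closed m_ac)
    then have "x \<otimes> inv \<rho> x = inv h"
      using hc x by simp
    then show ?thesis
      using subgroup.m_inv_closed[OF I h(1)] by simp
  qed
  \<comment> \<open>A positive number of colours common to the two colourings that are combined
    below.\<close>
  define R where "R = Suc (max r (card (rcosets I)))"
  obtain N C where NC: "recurrent_bound H G \<FF> (\<lambda>x. x) l (R ^ 2) N C"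
    using rec unfolding recurrent_def by blast
  \<comment> \<open>Turns a candidate for the identity into one for \<open>c\<close>: the point
    \<open>x\<close>, once translated into the image of \<open>c\<close>, is pulled back along
    \<open>c\<close>.\<close>
  define \<phi> where "\<phi> x = (SOME y. y \<in> carrier G \<and> c y = x \<otimes> inv \<rho> x)" for x
  have \<phi>: "\<phi> x \<in> carrier G" "c (\<phi> x) = x \<otimes> inv \<rho> x" if x: "x \<in> carrier G" for x
  proof -
    have "\<exists>y. y \<in> carrier G \<and> c y = x \<otimes> inv \<rho> x"
      using \<rho>I[OF x] unfolding I_def by force
    then show "\<phi> x \<in> carrier G" "c (\<phi> x) = x \<otimes> inv \<rho> x"
      unfolding \<phi>_def by (metis (mono_tags, lifting) someI_ex)+
  qed
  have "recurrent_bound H G \<FF> c l r N C"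
  proof (rule recurrent_boundI)
    fix F and hs :: "'c list"
    assume F: "F \<in> \<FF>" "F \<subseteq> carrier H \<rightarrow> carrier G" "finite F" "card F \<le> l"
      and hs: "set hs \<subseteq> carrier H" "length hs = N"
    obtain K where K: "K \<subseteq> carrier G" "finite K" "card K \<le> C"
      and *: "\<And>\<chi>. \<chi> \<in> carrier G \<rightarrow> {..<R ^ 2} \<Longrightarrow> \<exists>b \<in> K. \<exists>u \<in> subsums H hs. \<forall>f \<in> F.
            \<chi> (f u \<otimes> b) = \<chi> b"
      using recurrent_boundE[OF NC F hs] by metis
    have "\<exists>b \<in> \<phi> ` K. \<exists>u \<in> subsums H hs. \<forall>f \<in> F. \<chi> (f u \<otimes> c b) = \<chi> (c b)"
      if \<chi>: "\<chi> \<in> carrier G \<rightarrow> {..<r}" for \<chi>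
    proof -
      define \<kappa> where "\<kappa> i x = (if i then \<chi> (x \<otimes> inv \<rho> x) else e (I #> x))" for i x
      have "\<kappa> i \<in> carrier G \<rightarrow> {..<R}" for i
      proof
        fix x assume x: "x \<in> carrier G"
        have "\<chi> (x \<otimes> inv \<rho> x) < r"
          using \<chi> x \<rho>c[OF x] by (auto simp: Pi_iff)
        moreover have "e (I #> x) < card (rcosets I)"
          using bij_betw_apply[OF e] rcosetsI[OF subgroup.subset[OF I] x] by fastforce
        ultimately show "\<kappa> i x \<in> {..<R}"
          by (auto simp: \<kappa>_def R_def)
      qed
      then obtain \<psi> where \<psi>: "\<psi> \<in> carrier G \<rightarrow> {..<R ^ 2}"
        and eq: "\<And>x y i. \<lbrakk>x \<in> carrier G; y \<in> carrier G; \<psi> x = \<psi> y; i \<in> UNIV\<rbrakk> \<Longrightarrow> \<kappa> i x = \<kappa> i y"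
        using product_coloring[of "UNIV :: bool set" 2 R \<kappa> "carrier G"] by (auto simp: R_def)
      obtain b u where bu: "b \<in> K" "u \<in> subsums H hs" "\<And>f. f \<in> F \<Longrightarrow> \<psi> (f u \<otimes> b) = \<psi> b"
        using *[OF \<psi>] by blast
      have b: "b \<in> carrier G" and u: "u \<in> carrier H"
        using bu K comm_semigroup.subsums_closed[OF H hs(1)] by auto
      have "\<chi> (f u \<otimes> c (\<phi> b)) = \<chi> (c (\<phi> b))" if f: "f \<in> F" for f
      proof -
        have fu: "f u \<in> carrier G"
          using F f u by auto
        then have fb: "f u \<otimes> b \<in> carrier G"
          using b by simp
        have "\<kappa> True (f u \<otimes> b) = \<kappa> True b" "\<kappa> False (f u \<otimes> b) = \<kappa> False b"
          using eq[OF fb b bu(3)[OF f]] by auto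
        then have 1: "\<chi> (f u \<otimes> b \<otimes> inv \<rho> (f u \<otimes> b)) = \<chi> (b \<otimes> inv \<rho> b)"
          and "e (I #> (f u \<otimes> b)) = e (I #> b)"
          by (auto simp: \<kappa>_def)
        then have "I #> (f u \<otimes> b) = I #> b"
          using e rcosetsI[OF subgroup.subset[OF I]] fb b unfolding bij_betw_def inj_on_def by blast
        then have "\<rho> (f u \<otimes> b) = \<rho> b"
          by (simp add: \<rho>_def)
        with 1 show ?thesis
          using \<phi>(2)[OF b] fu b \<rho>c[OF b] by (simp add: m_assoc)
      qed
      then show ?thesis
        using bu by blast
    qed
    moreover have "\<phi> ` K \<subseteq> carrier G" "finite (\<phi> ` K)" "card (\<phi> ` K) \<le> C"
      using K \<phi>(1) card_image_le[of K \<phi>] by auto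
    ultimately show "\<exists>K. K \<subseteq> carrier G \<and> finite K \<and> card K \<le> C \<and>
        (\<forall>\<chi> \<in> carrier G \<rightarrow> {..<r}. \<exists>b \<in> K. \<exists>u \<in> subsums H hs. \<forall>f \<in> F.
            \<chi> (f u \<otimes> c b) = \<chi> (c b))"
      by (intro exI[of _ "\<phi> ` K"]) simp
  qed
  then show "\<exists>N C. recurrent_bound H G \<FF> c l r N C"
    by blast
qed

section \<open>Lists of pairs with good finite sums\<close>

lemma comm_semigroup_DirProd:
  assumes "comm_semigroup H" "comm_semigroup G"
  shows "comm_semigroup (H \<times>\<times> G)"
  using assms by (auto simp: comm_semigroup_def mult_DirProd')

lemma subsums_hom:
  assumes "comm_semigroup G" "set xs \<subseteq> carrier G"
    and "\<And>x y. \<lbrakk>x \<in> carrier G; y \<in> carrier G\<rbrakk> \<Longrightarrow> \<phi> (x \<otimes>\<^bsub>G\<^esub> y) = \<phi> x \<otimes>\<^bsub>G'\<^esub> \<phi> y"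
  shows "subsums G' (map \<phi> xs) = \<phi> ` subsums G xs"
  using assms(2)
proof (induction xs)
  case (Cons x xs)
  then have "\<phi> (x \<otimes>\<^bsub>G\<^esub> y) = \<phi> x \<otimes>\<^bsub>G'\<^esub> \<phi> y" if "y \<in> subsums G xs" for y
    using assms(3) that comm_semigroup.subsums_closed[OF assms(1), of xs] by auto
  then have "\<phi> ` (\<lambda>y. x \<otimes>\<^bsub>G\<^esub> y) ` subsums G xs = (\<lambda>y. \<phi> x \<otimes>\<^bsub>G'\<^esub> y) ` \<phi> ` subsums G xs"
    unfolding image_image by (rule image_cong[OF refl])
  then show ?case
    using Cons by (simp add: image_Un)
qed simp

context comm_semigroup
begin

text \<open>A pair \<open>(v, b)\<close> is a tuple already built, namely a sum of
  \<open>hs\<close>, with the coordinate to be appended. Adding pairs adds both components, so a sum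
  of pairs is again a tuple with a good extension.\<close>

definition pair_bound ::
  "('h, 'x) monoid_scheme \<Rightarrow> ('h \<Rightarrow> 'a) set \<Rightarrow> ('a \<Rightarrow> 'a) \<Rightarrow> nat \<Rightarrow> nat \<Rightarrow> nat \<Rightarrow> nat \<Rightarrow> nat \<Rightarrow> bool" where
  "pair_bound H \<F> c n l r N C \<longleftrightarrow>
     (\<forall>F hs. F \<subseteq> \<F> \<and> finite F \<and> card F \<le> l \<and> set hs \<subseteq> carrier H \<and> length hs = N \<longrightarrow>
       (\<exists>\<K>. (\<forall>ps \<in> \<K>. length ps = n \<and> set ps \<subseteq> carrier (H \<times>\<times> G) \<and>
              fst ` subsums (H \<times>\<times> G) ps \<subseteq> subsums H hs) \<and> finite \<K> \<and> card \<K> \<le> C \<and>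
         (\<forall>\<chi> \<in> carrier G \<rightarrow> {..<r}. \<exists>ps \<in> \<K>. \<forall>(v, b) \<in> subsums (H \<times>\<times> G) ps. \<forall>f \<in> F.
            \<chi> (f v \<otimes> c b) = \<chi> (c b))))"

lemma pair_boundD:
  assumes "pair_bound H \<F> c n l r N C"
    and "F \<subseteq> \<F>" "finite F" "card F \<le> l" "set hs \<subseteq> carrier H" "length hs = N"
  shows "\<exists>\<K>. (\<forall>ps \<in> \<K>. length ps = n \<and> set ps \<subseteq> carrier (H \<times>\<times> G) \<and>
              fst ` subsums (H \<times>\<times> G) ps \<subseteq> subsums H hs) \<and> finite \<K> \<and> card \<K> \<le> C \<and>
         (\<forall>\<chi> \<in> carrier G \<rightarrow> {..<r}. \<exists>ps \<in> \<K>. \<forall>(v, b) \<in> subsums (H \<times>\<times> G) ps. \<forall>f \<in> F.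
            \<chi> (f v \<otimes> c b) = \<chi> (c b))"
  using assms(1)[unfolded pair_bound_def, rule_format, of F hs] assms(2-) by simp

text \<open>The last pair of the list is chosen first as regards the colouring: it must preserve the colours of
  all translates by the finitely many candidates for the earlier pairs.\<close>

lemma pair_bound_exists:
  assumes H: "comm_semigroup H" and c: "c \<in> hom G G" and rec: "\<And>l. recurrent H G (Pow \<F>) c l"
    and \<F>: "\<F> \<subseteq> carrier H \<rightarrow> carrier G"
    and decomp: "\<And>f h. \<lbrakk>f \<in> \<F>; h \<in> carrier H\<rbrakk> \<Longrightarrow>
      \<exists>q \<in> \<F>. \<forall>x \<in> carrier H. f (h \<otimes>\<^bsub>H\<^esub> x) = f h \<otimes> q x"
  shows "\<exists>N C. pair_bound H \<F> c n l r N C"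
proof (induction n arbitrary: r)
  case 0
  have "pair_bound H \<F> c 0 l r 0 1"
    unfolding pair_bound_def by (intro allI impI exI[of _ "{[]}"]) auto
  then show ?case by blast
next
  case (Suc n)
  obtain N1 C1 where 1: "pair_bound H \<F> c n l (r ^ 2) N1 C1"
    using Suc by blast
  \<comment> \<open>\<open>l'\<close> counts \<open>F\<close> and the increments
    \<open>q f v\<close>, \<open>B\<close> the points \<open>c b\<close> and
    \<open>f v \<otimes> c b\<close>, where \<open>(v, b)\<close> runs over the at most
    \<open>2 ^ n\<close> sums of each of the \<open>C1\<close> candidate lists.\<close>
  define l' where "l' = l + C1 * (2 ^ n * l)"
  define B where "B = C1 * (2 ^ n + 2 ^ n * l)"
  have cc: "c \<in> carrier G \<rightarrow> carrier G"
    using c by (auto simp: hom_def)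
  obtain N2 C2 where 2: "shift_recurrent_bound H G (Pow \<F>) c l' r B N2 C2"
    by (rule recurrent_shift[OF rec cc H])
  have HG: "comm_semigroup (H \<times>\<times> G)"
    using H comm_semigroup_axioms by (rule comm_semigroup_DirProd)
  have "\<exists>q. \<forall>f \<in> \<F>. \<forall>h \<in> carrier H. q f h \<in> \<F> \<and> (\<forall>x \<in> carrier H. f (h \<otimes>\<^bsub>H\<^esub> x) = f h \<otimes> q f h x)"
    using decomp by metis
  then obtain q where q: "\<And>f h. \<lbrakk>f \<in> \<F>; h \<in> carrier H\<rbrakk> \<Longrightarrow> q f h \<in> \<F>"
    and fq: "\<And>f h x. \<lbrakk>f \<in> \<F>; h \<in> carrier H; x \<in> carrier H\<rbrakk> \<Longrightarrow> f (h \<otimes>\<^bsub>H\<^esub> x) = f h \<otimes> q f h x"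
    by metis
  have "pair_bound H \<F> c (Suc n) l r (N1 + N2) (C1 * (2 ^ N2 * C2))"
    unfolding pair_bound_def
  proof (intro allI impI; elim conjE)
    fix F and hs :: "'c list"
    assume F: "F \<subseteq> \<F>" and finF: "finite F" "card F \<le> l"
      and hs: "set hs \<subseteq> carrier H" "length hs = N1 + N2"
    define hs1 hs2 where "hs1 = take N1 hs" and "hs2 = drop N1 hs"
    have hs12: "hs = hs1 @ hs2" "length hs1 = N1" "length hs2 = N2"
      using hs by (auto simp: hs1_def hs2_def)
    then have sub: "set hs1 \<subseteq> carrier H" "set hs2 \<subseteq> carrier H"
      using hs by auto
    note cl2 = comm_semigroup.subsums_closed[OF H sub(2)]
    have Fc: "f x \<in> carrier G" if "f \<in> \<F>" "x \<in> carrier H" for f x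
      using that \<F> by auto
    obtain \<K> where \<K>: "\<forall>ps \<in> \<K>. length ps = n \<and> set ps \<subseteq> carrier (H \<times>\<times> G) \<and>
              fst ` subsums (H \<times>\<times> G) ps \<subseteq> subsums H hs1" and fin\<K>: "finite \<K>" "card \<K> \<le> C1"
      and good: "\<forall>\<chi> \<in> carrier G \<rightarrow> {..<r ^ 2}. \<exists>ps \<in> \<K>. \<forall>(v, b) \<in> subsums (H \<times>\<times> G) ps. \<forall>f \<in> F.
            \<chi> (f v \<otimes> c b) = \<chi> (c b)"
      using pair_boundD[OF 1 F finF sub(1) hs12(2)] by (elim exE conjE) (rule that)
    define S where "S ps = subsums (H \<times>\<times> G) ps" for ps
    have Sc: "v \<in> carrier H" "b \<in> carrier G" if "(v, b) \<in> S ps" "ps \<in> \<K>" for v b ps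
      using comm_semigroup.subsums_closed[OF HG, of ps] \<K> that by (auto simp: S_def)
    have cS: "finite (S ps)" "card (S ps) \<le> 2 ^ n" if "ps \<in> \<K>" for ps
      using card_subsums[of "H \<times>\<times> G" ps] \<K> that by (auto simp: S_def)
    define D where "D = F \<union> (\<Union>ps \<in> \<K>. (\<lambda>(x, f). q f (fst x)) ` (S ps \<times> F))"
    define Y where "Y = (\<Union>ps \<in> \<K>. (\<lambda>x. c (snd x)) ` S ps \<union> (\<lambda>(x, f). f (fst x) \<otimes> c (snd x)) ` (S ps \<times> F))"
    have DF: "D \<in> Pow \<F>"
      using F q Sc by (fastforce simp: D_def)
    have Dc: "D \<subseteq> carrier H \<rightarrow> carrier G"
      using DF \<F> by auto
    have D1: "finite ((\<lambda>(x, f). q f (fst x)) ` (S ps \<times> F))"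
      "card ((\<lambda>(x, f). q f (fst x)) ` (S ps \<times> F)) \<le> 2 ^ n * l" if "ps \<in> \<K>" for ps
      using card_image_prod_le[OF cS(1)[OF that] finF(1) cS(2)[OF that] finF(2)] by auto
    have "finite D"
      using finF fin\<K> D1 by (simp add: D_def)
    moreover have "card D \<le> l'"
    proof -
      have "card (\<Union>ps \<in> \<K>. (\<lambda>(x, f). q f (fst x)) ` (S ps \<times> F)) \<le> (\<Sum>ps\<in>\<K>. 2 ^ n * l)"
        using card_UN_le[OF fin\<K>(1)] sum_mono[OF D1(2)] by (rule order_trans)
      also have "\<dots> \<le> C1 * (2 ^ n * l)"
        using fin\<K> unfolding sum_constant by (simp only: of_nat_id mult_le_mono1)
      finally show ?thesis
        unfolding D_def l'_def using card_Un_le[of F] finF(2) by (meson add_le_mono order_trans)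
    qed
    ultimately have finD: "finite D" "card D \<le> l'" .
    have Yc: "Y \<subseteq> carrier G"
      using Sc cc Fc F by (fastforce simp: Y_def intro!: m_closed)
    have Y1: "finite ((\<lambda>x. c (snd x)) ` S ps \<union> (\<lambda>(x, f). f (fst x) \<otimes> c (snd x)) ` (S ps \<times> F))"
      "card ((\<lambda>x. c (snd x)) ` S ps \<union> (\<lambda>(x, f). f (fst x) \<otimes> c (snd x)) ` (S ps \<times> F)) \<le> 2 ^ n + 2 ^ n * l"
      if "ps \<in> \<K>" for ps
    proof -
      have "card ((\<lambda>(x, f). f (fst x) \<otimes> c (snd x)) ` (S ps \<times> F)) \<le> 2 ^ n * l"
        using card_image_prod_le[OF cS(1)[OF that] finF(1) cS(2)[OF that] finF(2)] by auto
      moreover have "card ((\<lambda>x. c (snd x)) ` S ps) \<le> 2 ^ n"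
        using card_image_le[OF cS(1)[OF that]] cS(2)[OF that] by (rule order_trans)
      ultimately show "card ((\<lambda>x. c (snd x)) ` S ps \<union> (\<lambda>(x, f). f (fst x) \<otimes> c (snd x)) ` (S ps \<times> F))
          \<le> 2 ^ n + 2 ^ n * l"
        by (meson add_le_mono card_Un_le order_trans)
    qed (use cS[OF that] finF in simp)
    have "finite Y"
      using fin\<K> Y1 by (simp add: Y_def)
    moreover have "card Y \<le> B"
    proof -
      have "card Y \<le> (\<Sum>ps\<in>\<K>. 2 ^ n + 2 ^ n * l)"
        unfolding Y_def using card_UN_le[OF fin\<K>(1)] sum_mono[OF Y1(2)] by (rule order_trans)
      also have "\<dots> \<le> B"
        using fin\<K> unfolding sum_constant B_def by (simp only: of_nat_id mult_le_mono1)
      finally show ?thesis .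
    qed
    ultimately have finY: "finite Y" "card Y \<le> B" .
    obtain K where K: "K \<subseteq> carrier G" "finite K" "card K \<le> C2"
      and inv: "\<And>\<chi> Y. \<lbrakk>\<chi> \<in> carrier G \<rightarrow> {..<r}; Y \<subseteq> carrier G; finite Y; card Y \<le> B\<rbrakk> \<Longrightarrow>
      \<exists>b \<in> K. \<exists>u \<in> subsums H hs2. \<forall>f \<in> D. \<chi> (f u \<otimes> c b) = \<chi> (c b) \<and>
        (\<forall>y \<in> Y. \<chi> (y \<otimes> (f u \<otimes> c b)) = \<chi> (y \<otimes> c b))"
      using shift_recurrent_boundE[OF 2 DF Dc finD sub(2) hs12(3)] by metis
    define \<L> where "\<L> = (\<lambda>(ps, p). ps @ [p]) ` (\<K> \<times> (subsums H hs2 \<times> K))"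
    have fs: "finite (subsums H hs2 \<times> K)" "card (subsums H hs2 \<times> K) \<le> 2 ^ N2 * C2"
      using K card_subsums[of H hs2] hs12 by (auto simp: card_cartesian_product intro!: mult_le_mono)
    have \<L>fin: "finite \<L>" "card \<L> \<le> C1 * (2 ^ N2 * C2)"
      using card_image_prod_le[OF fin\<K>(1) fs(1) fin\<K>(2) fs(2)] unfolding \<L>_def by auto
    have app: "subsums (H \<times>\<times> G) (ps @ [(u, b)]) =
        S ps \<union> {(u, b)} \<union> (\<lambda>(v, b'). (v \<otimes>\<^bsub>H\<^esub> u, b' \<otimes> b)) ` S ps"
      if "ps \<in> \<K>" "u \<in> carrier H" "b \<in> carrier G" for ps u b
    proof -
      have "(\<Union>x \<in> S ps. (\<lambda>y. x \<otimes>\<^bsub>H \<times>\<times> G\<^esub> y) ` {(u, b)}) = (\<lambda>(v, b'). (v \<otimes>\<^bsub>H\<^esub> u, b' \<otimes> b)) ` S ps"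
      proof -
        have "(\<Union>x \<in> S ps. (\<lambda>y. x \<otimes>\<^bsub>H \<times>\<times> G\<^esub> y) ` {(u, b)}) = (\<lambda>x. x \<otimes>\<^bsub>H \<times>\<times> G\<^esub> (u, b)) ` S ps"
          by auto
        also have "\<dots> = (\<lambda>(v, b'). (v \<otimes>\<^bsub>H\<^esub> u, b' \<otimes> b)) ` S ps"
          by (rule image_cong) auto
        finally show ?thesis .
      qed
      then show ?thesis
        using comm_semigroup.subsums_append[OF HG, of ps "[(u, b)]"] \<K> that by (simp add: S_def)
    qed
    have \<L>: "\<forall>ps \<in> \<L>. length ps = Suc n \<and> set ps \<subseteq> carrier (H \<times>\<times> G) \<and>
              fst ` subsums (H \<times>\<times> G) ps \<subseteq> subsums H hs"
    proof -
      have "length (ps @ [(u, b)]) = Suc n \<and> set (ps @ [(u, b)]) \<subseteq> carrier (H \<times>\<times> G) \<and>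
              fst ` subsums (H \<times>\<times> G) (ps @ [(u, b)]) \<subseteq> subsums H hs"
        if ps: "ps \<in> \<K>" and u: "u \<in> subsums H hs2" and b: "b \<in> K" for ps u b
      proof -
        have uc: "u \<in> carrier H" "b \<in> carrier G"
          using u b cl2 K by auto
        have "fst ` S ps \<subseteq> subsums H hs1"
          using \<K> ps by (simp add: S_def)
        then have "fst ` subsums (H \<times>\<times> G) (ps @ [(u, b)]) \<subseteq> subsums H hs"
          unfolding app[OF ps uc] hs12(1) comm_semigroup.subsums_append[OF H sub]
          using u by (fastforce simp: image_Un)
        then show ?thesis
          using \<K> ps uc by auto
      qed
      then show ?thesis
        unfolding \<L>_def by auto
    qed
    have "\<exists>ps \<in> \<L>. \<forall>(v, b) \<in> subsums (H \<times>\<times> G) ps. \<forall>f \<in> F. \<chi> (f v \<otimes> c b) = \<chi> (c b)"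
      if \<chi>: "\<chi> \<in> carrier G \<rightarrow> {..<r}" for \<chi>
    proof -
      obtain b u where b: "b \<in> K" and u: "u \<in> subsums H hs2"
        and inv1: "\<And>f. f \<in> D \<Longrightarrow> \<chi> (f u \<otimes> c b) = \<chi> (c b)"
        and inv2: "\<And>f y. \<lbrakk>f \<in> D; y \<in> Y\<rbrakk> \<Longrightarrow> \<chi> (y \<otimes> (f u \<otimes> c b)) = \<chi> (y \<otimes> c b)"
        using inv[OF \<chi> Yc finY] by blast
      have uc: "u \<in> carrier H" and bc: "b \<in> carrier G" and cb: "c b \<in> carrier G"
        using u b cl2 K cc by auto
      have "0 < r"
        using \<chi> cb by fastforce
      \<comment> \<open>The earlier pairs must be good for \<open>\<chi>\<close> itself and, for
        sums that include the new pair, for \<open>\<chi>\<close> translated by \<open>c b\<close>;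
        hence \<open>r ^ 2\<close> colours.\<close>
      define \<kappa> where "\<kappa> i x = (if i then \<chi> x else \<chi> (x \<otimes> c b))" for i x
      have "\<kappa> i \<in> carrier G \<rightarrow> {..<r}" for i
        using \<chi> cb m_closed by (auto simp: \<kappa>_def Pi_iff)
      then obtain \<psi> where \<psi>: "\<psi> \<in> carrier G \<rightarrow> {..<r ^ 2}"
        and eq: "\<And>x y i. \<lbrakk>x \<in> carrier G; y \<in> carrier G; \<psi> x = \<psi> y; i \<in> UNIV\<rbrakk> \<Longrightarrow> \<kappa> i x = \<kappa> i y"
        using product_coloring[of "UNIV :: bool set" 2 r \<kappa> "carrier G"] \<open>0 < r\<close> by auto
      obtain ps where ps: "ps \<in> \<K>"
        and ps_good: "\<And>v b' f. \<lbrakk>(v, b') \<in> S ps; f \<in> F\<rbrakk> \<Longrightarrow> \<psi> (f v \<otimes> c b') = \<psi> (c b')"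
        using bspec[OF good \<psi>] unfolding S_def by fast
      have new: "\<chi> (f v \<otimes> c b') = \<chi> (c b')" "\<chi> (f v \<otimes> c b' \<otimes> c b) = \<chi> (c b' \<otimes> c b)"
        if "(v, b') \<in> S ps" "f \<in> F" for v b' f
      proof -
        have "c b' \<in> carrier G" "f v \<otimes> c b' \<in> carrier G"
          using Sc[OF that(1) ps] Fc that F cc by (auto intro!: m_closed)
        then have "\<kappa> i (f v \<otimes> c b') = \<kappa> i (c b')" for i
          using eq ps_good[OF that] by blast
        from this[of True] this[of False] show "\<chi> (f v \<otimes> c b') = \<chi> (c b')"
          "\<chi> (f v \<otimes> c b' \<otimes> c b) = \<chi> (c b' \<otimes> c b)"
          by (auto simp: \<kappa>_def)
      qed
      \<comment> \<open>The point equals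
        \<open>(f v \<otimes> c b') \<otimes> (q f v u \<otimes> c b)\<close>. First
        \<open>inv2\<close> removes \<open>q f v u\<close>, then \<open>new\<close> removes
        \<open>f v\<close>.\<close>
      have comb: "\<chi> (f (v \<otimes>\<^bsub>H\<^esub> u) \<otimes> c (b' \<otimes> b)) = \<chi> (c (b' \<otimes> b))"
        if vb: "(v, b') \<in> S ps" and f: "f \<in> F" for v b' f
      proof -
        have vc: "v \<in> carrier H" "b' \<in> carrier G" "c b' \<in> carrier G" and ff: "f \<in> \<F>"
          using Sc[OF vb ps] cc F f by auto
        have cl: "f v \<in> carrier G" "q f v u \<in> carrier G"
          using Fc ff vc q uc by blast+
        have "c (b' \<otimes> b) = c b' \<otimes> c b"
          using c vc bc by (simp add: hom_mult)
        moreover have "f (v \<otimes>\<^bsub>H\<^esub> u) \<otimes> (c b' \<otimes> c b) = (f v \<otimes> c b') \<otimes> (q f v u \<otimes> c b)"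
          using fq[OF ff vc(1) uc] cl vc cb by (simp add: m_ac m_closed)
        moreover have "\<chi> ((f v \<otimes> c b') \<otimes> (q f v u \<otimes> c b)) = \<chi> ((f v \<otimes> c b') \<otimes> c b)"
        proof (rule inv2)
          show "q f v \<in> D" "f v \<otimes> c b' \<in> Y"
            using vb f ps by (force simp: D_def Y_def)+
        qed
        ultimately show ?thesis
          using new(2)[OF vb f] by simp
      qed
      have "\<forall>(v, b) \<in> subsums (H \<times>\<times> G) (ps @ [(u, b)]). \<forall>f \<in> F. \<chi> (f v \<otimes> c b) = \<chi> (c b)"
        unfolding app[OF ps uc bc] using new(1) comb inv1 by (auto simp: D_def)
      moreover have "ps @ [(u, b)] \<in> \<L>"
        using ps u b by (auto simp: \<L>_def)
      ultimately show ?thesis by blast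
    qed
    with \<L>fin \<L> show "\<exists>\<K>. (\<forall>ps \<in> \<K>. length ps = Suc n \<and> set ps \<subseteq> carrier (H \<times>\<times> G) \<and>
              fst ` subsums (H \<times>\<times> G) ps \<subseteq> subsums H hs) \<and> finite \<K> \<and> card \<K> \<le> C1 * (2 ^ N2 * C2) \<and>
         (\<forall>\<chi> \<in> carrier G \<rightarrow> {..<r}. \<exists>ps \<in> \<K>. \<forall>(v, b) \<in> subsums (H \<times>\<times> G) ps. \<forall>f \<in> F.
            \<chi> (f v \<otimes> c b) = \<chi> (c b))"
      by (intro exI[of _ \<L>]) simp
  qed
  then show ?case by blast
qed

end

section \<open>Building the tuples level by level\<close>

context comm_semigroup
begin

lemma comm_semigroup_power: "comm_semigroup (power_structure G p)"
proof unfold_locales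
  fix x y z
  assume x: "x \<in> carrier (power_structure G p)" and y: "y \<in> carrier (power_structure G p)"
    and z: "z \<in> carrier (power_structure G p)"
  have mem: "x i \<in> carrier G" "y i \<in> carrier G" "z i \<in> carrier G" if "i < p" for i
    using x y z that by (auto simp: PiE_iff)
  show "x \<otimes>\<^bsub>power_structure G p\<^esub> y \<otimes>\<^bsub>power_structure G p\<^esub> z
      = x \<otimes>\<^bsub>power_structure G p\<^esub> (y \<otimes>\<^bsub>power_structure G p\<^esub> z)"
    unfolding mult_product_group by (rule restrict_ext) (simp add: mem m_assoc)
next
  fix x y
  assume x: "x \<in> carrier (power_structure G p)" and y: "y \<in> carrier (power_structure G p)"
  have mem: "x i \<in> carrier G" "y i \<in> carrier G" if "i < p" for i
    using x y that by (auto simp: PiE_iff)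
  show "x \<otimes>\<^bsub>power_structure G p\<^esub> y \<in> carrier (power_structure G p)"
    unfolding mult_product_group carrier_product_group
    by (intro restrict_PiE_iff[THEN iffD2] ballI) (simp add: mem m_closed)
  show "x \<otimes>\<^bsub>power_structure G p\<^esub> y = y \<otimes>\<^bsub>power_structure G p\<^esub> x"
    unfolding mult_product_group by (rule restrict_ext) (simp add: mem m_comm)
qed

text \<open>At most one element qualifies: if z + w and z' + w are both identities, then z = (z' +
  w) + z = (z + w) + z' = z'.\<close>

lemma finite_not_nonidentity_mult:
  assumes "w \<in> carrier G"
  shows "finite {z \<in> carrier G. z \<otimes> w \<notin> nonidentity G}"
proof -
  have "z = z'" if z: "z \<in> carrier G" "z \<otimes> w \<notin> nonidentity G"
    and z': "z' \<in> carrier G" "z' \<otimes> w \<notin> nonidentity G" for z z'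
  proof -
    have "z = (z' \<otimes> w) \<otimes> z"
      using z z' assms by (auto simp: nonidentity_def m_closed)
    also have "\<dots> = (z \<otimes> w) \<otimes> z'"
      using z z' assms by (simp add: m_ac m_closed)
    also have "\<dots> = z'"
      using z z' assms by (auto simp: nonidentity_def m_closed)
    finally show ?thesis .
  qed
  then have "{z \<in> carrier G. z \<otimes> w \<notin> nonidentity G} \<subseteq> {THE z. z \<in> carrier G \<and> z \<otimes> w \<notin> nonidentity G}"
    by (auto intro!: the_equality[symmetric])
  then show ?thesis
    using finite_subset by blast
qed

lemma finite_not_nonidentity: "finite (carrier G - nonidentity G)"
proof -
  have "z = z'" if z: "z \<in> carrier G - nonidentity G" and z': "z' \<in> carrier G - nonidentity G" for z z'
    using z z' by (auto simp: nonidentity_def)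
  then have "carrier G - nonidentity G \<subseteq> {THE z. z \<in> carrier G - nonidentity G}"
    by (auto intro!: the_equality[symmetric])
  then show ?thesis
    using finite_subset by blast
qed

text \<open>Greedy choice: the next value of \<open>c\<close> has to avoid only the identity and the
  inverses of \<open>c u\<close> for the finitely many sums \<open>u\<close> so far.\<close>

lemma nonidentity_subsums_exists:
  assumes c: "c \<in> hom G G" and inf: "infinite (c ` carrier G)"
  shows "\<exists>xs. length xs = n \<and> set xs \<subseteq> carrier G \<and> c ` subsums G xs \<subseteq> nonidentity G"
proof (induction n)
  case (Suc n)
  then obtain xs where xs: "length xs = n" "set xs \<subseteq> carrier G" "c ` subsums G xs \<subseteq> nonidentity G"
    by blast
  have cl: "u \<in> carrier G" "c u \<in> carrier G" if "u \<in> subsums G xs" for u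
    using subsums_closed[OF xs(2)] c that by (auto simp: hom_def)
  define B where "B = (carrier G - nonidentity G) \<union>
    (\<Union>u \<in> subsums G xs. {z \<in> carrier G. z \<otimes> c u \<notin> nonidentity G})"
  have "finite B"
    using finite_not_nonidentity finite_not_nonidentity_mult cl by (auto simp: B_def)
  then have "\<not> c ` carrier G \<subseteq> B"
    using inf finite_subset by metis
  then obtain y where y: "y \<in> carrier G" "c y \<notin> B"
    by blast
  have cy: "c y \<in> carrier G"
    using c y by (auto simp: hom_def)
  then have cy': "c y \<in> nonidentity G"
    using y by (auto simp: B_def)
  have "c (y \<otimes> u) \<in> nonidentity G" if "u \<in> subsums G xs" for u
  proof -
    have "c (y \<otimes> u) = c y \<otimes> c u"
      using c y cl[OF that] by (simp add: hom_mult)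
    then show ?thesis
      using y cy that by (auto simp: B_def)
  qed
  then show ?case
    using xs y cy' by (intro exI[of _ "y # xs"]) auto
qed simp

text \<open>Appending a coordinate does not disturb the conditions for smaller \<open>j\<close>,
  which involve only the coordinates up to \<open>j\<close>. They hold for every sum of the previous
  list, and the tuples extended here are such sums.\<close>

lemma levels_exist:
  fixes r :: nat
  assumes c: "c \<in> hom G G" and inf: "infinite (c ` carrier G)" and \<chi>: "\<chi> \<in> carrier G \<rightarrow> {..<r}"
    and F: "\<And>p. 1 \<le> p \<Longrightarrow> F p \<subseteq> \<F> p \<and> finite (F p)"
    and rec: "\<And>p l. 1 \<le> p \<Longrightarrow> recurrent (power_structure G p) G (Pow (\<F> p)) c l"
    and \<F>: "\<And>p. 1 \<le> p \<Longrightarrow> \<F> p \<subseteq> carrier (power_structure G p) \<rightarrow> carrier G"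
    and decomp: "\<And>p f h. \<lbrakk>1 \<le> p; f \<in> \<F> p; h \<in> carrier (power_structure G p)\<rbrakk> \<Longrightarrow>
      \<exists>q \<in> \<F> p. \<forall>x \<in> carrier (power_structure G p).
        f (h \<otimes>\<^bsub>power_structure G p\<^esub> x) = f h \<otimes> q x"
  shows "\<exists>hs. length hs = n \<and> set hs \<subseteq> carrier (power_structure G (Suc p)) \<and>
    (\<forall>s \<in> subsums (power_structure G (Suc p)) hs. c (s 0) \<in> nonidentity G \<and>
      (\<forall>j \<in> {1..p}. \<forall>f \<in> F j. \<chi> (f (restrict s {..<j}) \<otimes> c (s j)) = \<chi> (c (s j))))"
proof (induction p arbitrary: n)
  case 0
  obtain xs where xs: "length xs = n" "set xs \<subseteq> carrier G" "c ` subsums G xs \<subseteq> nonidentity G"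
    using nonidentity_subsums_exists[OF c inf] by blast
  define \<phi> where "\<phi> x = (\<lambda>i\<in>{..<Suc 0}. x)" for x :: 'a
  have "subsums (power_structure G (Suc 0)) (map \<phi> xs) = \<phi> ` subsums G xs"
    by (rule subsums_hom[OF comm_semigroup_axioms xs(2)]) (auto simp: \<phi>_def)
  moreover have "\<phi> x \<in> carrier (power_structure G (Suc 0))" if "x \<in> carrier G" for x
    using that unfolding \<phi>_def carrier_product_group by (intro restrict_PiE_iff[THEN iffD2]) simp
  then have "set (map \<phi> xs) \<subseteq> carrier (power_structure G (Suc 0))"
    using xs(2) unfolding set_map by blast
  moreover have "\<phi> x 0 = x" for x
    by (simp add: \<phi>_def)
  ultimately show ?case
    using xs by (intro exI[of _ "map \<phi> xs"]) (auto simp del: carrier_product_group)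
next
  case (Suc p)
  let ?H = "power_structure G (Suc p)"
  have H: "comm_semigroup ?H"
    by (rule comm_semigroup_power)
  have one: "1 \<le> Suc p" by simp
  have "\<exists>N C. pair_bound ?H (\<F> (Suc p)) c n (card (F (Suc p))) r N C"
    by (rule pair_bound_exists[OF H c rec[OF one] \<F>[OF one]]) (rule decomp[OF one])
  then obtain N C where NC: "pair_bound ?H (\<F> (Suc p)) c n (card (F (Suc p))) r N C"
    by blast
  obtain hs where hs: "length hs = N" "set hs \<subseteq> carrier ?H"
    and hs_good: "\<forall>s \<in> subsums ?H hs. c (s 0) \<in> nonidentity G \<and>
      (\<forall>j \<in> {1..p}. \<forall>f \<in> F j. \<chi> (f (restrict s {..<j}) \<otimes> c (s j)) = \<chi> (c (s j)))"
    using Suc.IH[of N] by (elim exE conjE) (rule that)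
  have Fp: "F (Suc p) \<subseteq> \<F> (Suc p)" "finite (F (Suc p))"
    using F[OF one] by auto
  obtain \<K> where \<K>: "\<forall>ps \<in> \<K>. length ps = n \<and> set ps \<subseteq> carrier (?H \<times>\<times> G) \<and>
              fst ` subsums (?H \<times>\<times> G) ps \<subseteq> subsums ?H hs"
    and good: "\<forall>\<chi> \<in> carrier G \<rightarrow> {..<r}. \<exists>ps \<in> \<K>. \<forall>(v, b) \<in> subsums (?H \<times>\<times> G) ps. \<forall>f \<in> F (Suc p).
            \<chi> (f v \<otimes> c b) = \<chi> (c b)"
    using pair_boundD[OF NC Fp order_refl hs(2,1)] by (elim exE conjE) (rule that)
  obtain ps where "ps \<in> \<K>" and ps_good: "\<And>v b f. \<lbrakk>(v, b) \<in> subsums (?H \<times>\<times> G) ps; f \<in> F (Suc p)\<rbrakk> \<Longrightarrow>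
            \<chi> (f v \<otimes> c b) = \<chi> (c b)"
    using bspec[OF good \<chi>] by fast
  then have ps: "length ps = n" "set ps \<subseteq> carrier (?H \<times>\<times> G)" "fst ` subsums (?H \<times>\<times> G) ps \<subseteq> subsums ?H hs"
    using \<K> by auto
  have HG: "comm_semigroup (?H \<times>\<times> G)"
    using H comm_semigroup_axioms by (rule comm_semigroup_DirProd)
  \<comment> \<open>Appends \<open>b\<close> to \<open>v\<close>. Since this is multiplicative, the
    sums of the extended tuples are the extensions given by sums of pairs.\<close>
  define \<phi> where "\<phi> = (\<lambda>(v, b). v(Suc p := b) :: nat \<Rightarrow> 'a)"
  let ?H' = "power_structure G (Suc (Suc p))"
  have \<phi>c: "\<phi> x \<in> carrier ?H'" if "x \<in> carrier (?H \<times>\<times> G)" for x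
  proof (cases x)
    case (Pair v b)
    then have "v(Suc p := b) \<in> insert (Suc p) {..<Suc p} \<rightarrow>\<^sub>E carrier G"
      using that by (intro PiE_fun_upd) auto
    then show ?thesis
      by (simp add: \<phi>_def Pair lessThan_Suc[of "Suc p"])
  qed
  have "\<phi> (x \<otimes>\<^bsub>?H \<times>\<times> G\<^esub> y) = \<phi> x \<otimes>\<^bsub>?H'\<^esub> \<phi> y"
    if "x \<in> carrier (?H \<times>\<times> G)" "y \<in> carrier (?H \<times>\<times> G)" for x y
    by (rule ext) (simp add: \<phi>_def mult_DirProd' case_prod_beta)
  then have sub: "subsums ?H' (map \<phi> ps) = \<phi> ` subsums (?H \<times>\<times> G) ps"
    by (rule subsums_hom[OF HG ps(2)])
  have "c (s 0) \<in> nonidentity G \<and>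
      (\<forall>j \<in> {1..Suc p}. \<forall>f \<in> F j. \<chi> (f (restrict s {..<j}) \<otimes> c (s j)) = \<chi> (c (s j)))"
    if "s \<in> subsums ?H' (map \<phi> ps)" for s
  proof -
    obtain v b where vb: "(v, b) \<in> subsums (?H \<times>\<times> G) ps" and s: "s = v(Suc p := b)"
    proof -
      obtain x where "x \<in> subsums (?H \<times>\<times> G) ps" "s = \<phi> x"
        using \<open>s \<in> subsums ?H' (map \<phi> ps)\<close> unfolding sub by blast
      then show thesis
        by (cases x) (rule that, auto simp: \<phi>_def)
    qed
    have v: "v \<in> subsums ?H hs"
      using ps(3) vb by force
    then have "v \<in> carrier ?H"
      using comm_semigroup.subsums_closed[OF H hs(2)] by blast
    \<comment> \<open>Cutting off the appended coordinate has to return \<open>v\<close> as a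
      function, since \<open>f\<close> is applied to the restricted tuple itself.\<close>
    then have "v \<in> extensional {..<Suc p}"
      by (simp add: PiE_def)
    then have "restrict s {..<Suc p} = v"
      unfolding s by (intro extensionalityI[of _ "{..<Suc p}"]) auto
    moreover have "restrict s {..<j} = restrict v {..<j}" if "j \<le> p" for j
      using that by (auto simp: s restrict_def fun_eq_iff)
    moreover have "s j = v j" if "j \<le> p" for j
      using that by (simp add: s)
    moreover have "s (Suc p) = b"
      by (simp add: s)
    ultimately show ?thesis
      using bspec[OF hs_good v] ps_good[OF vb] by (auto simp: le_Suc_eq)
  qed
  moreover have "set (map \<phi> ps) \<subseteq> carrier ?H'"
    using ps(2) \<phi>c unfolding set_map by blast
  ultimately show ?case
    using ps(1) by (intro exI[of _ "map \<phi> ps"]) (simp only: length_map, blast)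
qed

section \<open>Selecting levels of equal colour\<close>

lemma pigeonhole_levels:
  fixes \<kappa> :: "nat \<Rightarrow> nat"
  assumes "\<And>j. j \<le> m * r \<Longrightarrow> \<kappa> j < r"
  obtains e i where "e < r" "\<And>k. k \<le> m \<Longrightarrow> i k \<le> m * r \<and> \<kappa> (i k) = e"
    and "\<And>k l. \<lbrakk>k < l; l \<le> m\<rbrakk> \<Longrightarrow> i k < i l"
proof -
  have "\<exists>e < r. m < card {j. j \<le> m * r \<and> \<kappa> j = e}"
  proof (rule ccontr)
    assume "\<not> (\<exists>e < r. m < card {j. j \<le> m * r \<and> \<kappa> j = e})"
    then have le: "card {j. j \<le> m * r \<and> \<kappa> j = e} \<le> m" if "e \<in> {..<r}" for e
      using that by (metis lessThan_iff not_less)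
    have "{..m * r} = (\<Union>e \<in> {..<r}. {j. j \<le> m * r \<and> \<kappa> j = e})"
      using assms by auto
    then have "card {..m * r} \<le> (\<Sum>e\<in>{..<r}. card {j. j \<le> m * r \<and> \<kappa> j = e})"
      using card_UN_le[of "{..<r}" "\<lambda>e. {j. j \<le> m * r \<and> \<kappa> j = e}"] by simp
    also have "\<dots> \<le> (\<Sum>e\<in>{..<r}. m)"
      using le by (rule sum_mono)
    finally show False by (simp add: mult.commute)
  qed
  then obtain e where e: "e < r" "m < card {j. j \<le> m * r \<and> \<kappa> j = e}" by blast
  define J where "J = {j. j \<le> m * r \<and> \<kappa> j = e}"
  have finJ: "finite J"
    by (simp add: J_def)
  define i where "i k = sorted_list_of_set J ! k" for k
  have len: "m < length (sorted_list_of_set J)"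
    using e by (simp add: J_def)
  have "i k \<in> J" if "k \<le> m" for k
    using nth_mem[of k "sorted_list_of_set J"] len that finJ by (simp add: i_def)
  moreover have "i k < i l" if "k < l" "l \<le> m" for k l
    using sorted_wrt_nth_less[OF strict_sorted_list_of_set[of J], of k l] that len
    by (simp add: i_def)
  ultimately show thesis
    using that[OF e(1), of i] by (auto simp: J_def)
qed

text \<open>The conditions common to both cases. \<open>decomp\<close> allows tuples to be added,
  \<open>sel\<close> lets functions read arbitrary earlier levels, and \<open>c_nonid\<close> is
  needed because the construction controls the values \<open>c (s j)\<close>, whereas the
  coordinates \<open>s j\<close> themselves must not be the identity.\<close>

theorem partition_regularI:
  assumes sh: "shape G m F c" and inf: "infinite (c ` carrier G)"
    and c_nonid: "\<And>x. \<lbrakk>x \<in> carrier G; c x \<in> nonidentity G\<rbrakk> \<Longrightarrow> x \<in> nonidentity G"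
    and rec: "\<And>p l. 1 \<le> p \<Longrightarrow> recurrent (power_structure G p) G (Pow (\<F> p)) c l"
    and \<F>: "\<And>p. 1 \<le> p \<Longrightarrow> \<F> p \<subseteq> carrier (power_structure G p) \<rightarrow> carrier G"
    and decomp: "\<And>p f h. \<lbrakk>1 \<le> p; f \<in> \<F> p; h \<in> carrier (power_structure G p)\<rbrakk> \<Longrightarrow>
      \<exists>q \<in> \<F> p. \<forall>x \<in> carrier (power_structure G p).
        f (h \<otimes>\<^bsub>power_structure G p\<^esub> x) = f h \<otimes> q x"
    and proj: "\<And>p. 1 \<le> p \<Longrightarrow> (\<lambda>s. c (s 0)) \<in> \<F> p"
    and sel: "\<And>p t f i. \<lbrakk>1 \<le> p; t \<in> {1..m}; f \<in> F t; i \<in> {..<t} \<rightarrow> {..<p}\<rbrakk> \<Longrightarrow>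
      (\<lambda>s. f (\<lambda>k\<in>{..<t}. s (i k))) \<in> \<F> p"
  shows "partition_regular G m F c"
  unfolding partition_regular_def
proof (intro allI impI; elim conjE)
  fix P
  assume P: "finite P" "partition_on (carrier G) P"
  have c: "c \<in> hom G G" and m: "1 \<le> m" and finF: "\<And>t. t \<in> {1..m} \<Longrightarrow> finite (F t)"
    using sh by (auto simp: shape_def)
  obtain e where e: "bij_betw e P {0..<card P}"
    using P ex_bij_betw_finite_nat by blast
  define blk where "blk x = (THE X. X \<in> P \<and> x \<in> X)" for x
  have blk: "blk x \<in> P" "x \<in> blk x" if "x \<in> carrier G" for x
  proof -
    have "\<exists>!X. X \<in> P \<and> x \<in> X"
      using P(2) that unfolding partition_on_def disjoint_def by blast
    from theI'[OF this] show "blk x \<in> P" "x \<in> blk x"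
      by (auto simp: blk_def)
  qed
  \<comment> \<open>An identity gets a colour of its own. Since $c(s_0) + c(s_j)$ and $c(s_j)$ have the same
    colour and $c(s_0)$ is not an identity, no $c(s_j)$ is one.\<close>
  define \<chi> where "\<chi> x = (if x \<in> nonidentity G then e (blk x) else card P)" for x
  define r where "r = Suc (card P)"
  have eP: "e (blk x) < card P" if "x \<in> carrier G" for x
    using bij_betw_apply[OF e blk(1)[OF that]] by simp
  then have \<chi>: "\<chi> \<in> carrier G \<rightarrow> {..<r}"
    by (fastforce simp: \<chi>_def r_def)
  \<comment> \<open>Which levels will be used is decided only after the tuple exists, so every way
    of reading \<open>t\<close> of the first \<open>p\<close> coordinates is included in
    advance.\<close>
  define F' where "F' (p :: nat) = insert (\<lambda>s :: nat \<Rightarrow> 'a. c (s 0))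
    (\<Union>t \<in> {1..m}. (\<lambda>(f, i). \<lambda>s. f (\<lambda>k\<in>{..<t}. s (i k))) ` (F t \<times> ({..<t} \<rightarrow>\<^sub>E {..<p})))" for p
  have "F' p \<subseteq> \<F> p \<and> finite (F' p)" if "1 \<le> p" for p
  proof
    show "F' p \<subseteq> \<F> p"
      using proj[OF that] sel[OF that] by (fastforce simp: F'_def PiE_iff)
    show "finite (F' p)"
      unfolding F'_def using finF
      by (intro finite.insertI finite_UN_I finite_imageI finite_cartesian_product finite_PiE) auto
  qed
  then have levels: "\<exists>hs. length hs = 1 \<and> set hs \<subseteq> carrier (power_structure G (Suc (m * r))) \<and>
    (\<forall>s \<in> subsums (power_structure G (Suc (m * r))) hs. c (s 0) \<in> nonidentity G \<and>
      (\<forall>j \<in> {1..m * r}. \<forall>f \<in> F' j. \<chi> (f (restrict s {..<j}) \<otimes> c (s j)) = \<chi> (c (s j))))"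
    by (rule levels_exist[OF c inf \<chi> _ rec \<F> decomp])
  obtain hs where hs: "length hs = 1" "set hs \<subseteq> carrier (power_structure G (Suc (m * r)))"
    and hs_good: "\<forall>s \<in> subsums (power_structure G (Suc (m * r))) hs. c (s 0) \<in> nonidentity G \<and>
      (\<forall>j \<in> {1..m * r}. \<forall>f \<in> F' j. \<chi> (f (restrict s {..<j}) \<otimes> c (s j)) = \<chi> (c (s j)))"
    using levels by (elim exE conjE) (rule that)
  define s where "s = hs ! 0"
  have "s \<in> subsums (power_structure G (Suc (m * r))) hs" and s_mem: "s \<in> carrier (power_structure G (Suc (m * r)))"
    using hs by (auto simp: s_def length_Suc_conv)
  then have s0: "c (s 0) \<in> nonidentity G"
    and inv: "\<And>j f. \<lbrakk>j \<in> {1..m * r}; f \<in> F' j\<rbrakk> \<Longrightarrow> \<chi> (f (restrict s {..<j}) \<otimes> c (s j)) = \<chi> (c (s j))"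
    using hs_good by blast+
  have sc: "s j \<in> carrier G" "c (s j) \<in> carrier G" if "j \<le> m * r" for j
  proof -
    show "s j \<in> carrier G"
      using s_mem that by (auto simp: PiE_iff)
    then show "c (s j) \<in> carrier G"
      using c by (auto simp: hom_def)
  qed
  have \<chi>nonid: "x \<in> nonidentity G \<longleftrightarrow> \<chi> x < card P" if "x \<in> carrier G" for x
    using eP[OF that] by (simp add: \<chi>_def)
  have nonid: "c (s j) \<in> nonidentity G" if j: "j \<le> m * r" for j
  proof (rule ccontr)
    assume n: "c (s j) \<notin> nonidentity G"
    then have "j \<noteq> 0"
      using s0 by metis
    then have "\<chi> (c (s 0) \<otimes> c (s j)) = \<chi> (c (s j))"
      using inv[of j "\<lambda>s. c (s 0)"] j by (simp add: F'_def)
    moreover have "c (s 0) \<otimes> c (s j) = c (s 0)"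
      using n sc[OF j] sc[of 0] by (auto simp: nonidentity_def)
    ultimately show False
      using n s0 \<chi>nonid sc j by (metis le0)
  qed
  have "\<chi> (c (s j)) < r" if "j \<le> m * r" for j
    using \<chi> sc[OF that] by auto
  then obtain a i where "a < r" and ia: "\<And>k. k \<le> m \<Longrightarrow> i k \<le> m * r \<and> \<chi> (c (s (i k))) = a"
    and mono: "\<And>k l. \<lbrakk>k < l; l \<le> m\<rbrakk> \<Longrightarrow> i k < i l"
    using pigeonhole_levels[of m r "\<lambda>j. \<chi> (c (s j))"] by blast
  define s' where "s' = (\<lambda>k\<in>{..m}. s (i k))"
  define C where "C = blk (c (s (i 0)))"
  have aP: "a < card P"
    using nonid ia[of 0] \<chi>nonid sc by auto
  have inC: "x \<in> C" if "x \<in> carrier G" "\<chi> x = a" for x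
  proof -
    have "x \<in> nonidentity G" "c (s (i 0)) \<in> nonidentity G"
      using \<chi>nonid that aP nonid ia[of 0] by auto
    then have "e (blk x) = e (blk (c (s (i 0))))"
      using that ia[of 0] by (simp add: \<chi>_def)
    then have "blk x = C"
      using e blk(1) that sc ia[of 0] unfolding bij_betw_def inj_on_def C_def by blast
    then show ?thesis
      using blk(2) that by blast
  qed
  have "shape_set G m F c s' \<subseteq> C"
    unfolding shape_set_def
  proof (intro Un_least UN_least)
    show "{c (s' 0)} \<subseteq> C"
      using inC sc ia[of 0] by (auto simp: s'_def)
  next
    fix t assume t: "t \<in> {1..m}"
    have "f (restrict s' {..<t}) \<otimes> c (s' t) \<in> C" if f: "f \<in> F t" for f
    proof -
      define g where "g = (\<lambda>s. f (\<lambda>k\<in>{..<t}. s (restrict i {..<t} k)))"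
      have it: "i k < i t" if "k < t" for k
        using mono that t by auto
      have i1: "i t \<in> {1..m * r}"
        using it[of 0] ia[of t] t by auto
      have "restrict i {..<t} \<in> {..<t} \<rightarrow>\<^sub>E {..<i t}"
        using it by auto
      then have gF: "g \<in> F' (i t)"
        using t f unfolding F'_def g_def by (intro insertI2 UN_I[OF t] image_eqI[of _ _ "(f, restrict i {..<t})"]) auto
      have "g (restrict s {..<i t}) = f (restrict s' {..<t})"
      proof -
        have "(\<lambda>k\<in>{..<t}. restrict s {..<i t} (restrict i {..<t} k)) = restrict s' {..<t}"
          by (rule restrict_ext) (use it t in \<open>simp add: s'_def\<close>)
        then show ?thesis
          by (simp only: g_def)
      qed
      then have 1: "\<chi> (f (restrict s' {..<t}) \<otimes> c (s (i t))) = \<chi> (c (s (i t)))"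
        using inv[OF i1 gF] by simp
      have "f (restrict s' {..<t}) \<in> carrier G"
      proof -
        have "restrict s' {..<t} \<in> carrier (power_structure G t)"
          unfolding carrier_product_group using t sc ia
          by (intro restrict_PiE_iff[THEN iffD2] ballI) (auto simp: s'_def)
        moreover have "f \<in> carrier (power_structure G t) \<rightarrow> carrier G"
          using sh t f unfolding shape_def by blast
        ultimately show ?thesis
          by (rule Pi_mem[rotated])
      qed
      moreover have "i t \<le> m * r" "s' t = s (i t)" "\<chi> (c (s (i t))) = a"
        using ia[of t] t by (auto simp: s'_def)
      ultimately show ?thesis
        using 1 by (simp add: inC sc m_closed)
    qed
    then show "{f (restrict s' {..<t}) \<otimes> c (s' t) |f. f \<in> F t} \<subseteq> C"
      by blast
  qed
  moreover have "s' \<in> {..m} \<rightarrow>\<^sub>E nonidentity G"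
    unfolding s'_def using c_nonid nonid sc ia by (intro restrict_PiE_iff[THEN iffD2] ballI) auto
  moreover have "C \<in> P"
    using blk sc ia[of 0] by (auto simp: C_def)
  ultimately show "\<exists>C \<in> P. \<exists>s \<in> {..m} \<rightarrow>\<^sub>E nonidentity G. shape_set G m F c s \<subseteq> C"
    by blast
qed

end

section \<open>The two cases\<close>

lemma comm_group_power:
  assumes "comm_group G"
  shows "comm_group (power_structure G p)"
proof -
  interpret comm_group G by fact
  interpret p: comm_semigroup "power_structure G p"
    by (rule comm_semigroup.comm_semigroup_power[OF comm_semigroup])
  have "group (power_structure G p)"
    by (rule product_group) (rule is_group)
  then show ?thesis
    using p.m_comm by (rule group.group_comm_groupI)
qed

lemma select_coordinates_hom:
  assumes "i \<in> {..<t} \<rightarrow> {..<p}"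
  shows "(\<lambda>s. \<lambda>k\<in>{..<t}. s (i k)) \<in> hom (power_structure G p) (power_structure G t)"
proof (rule homI)
  fix x y
  show "(\<lambda>k\<in>{..<t}. (x \<otimes>\<^bsub>power_structure G p\<^esub> y) (i k)) =
    (\<lambda>k\<in>{..<t}. x (i k)) \<otimes>\<^bsub>power_structure G t\<^esub> (\<lambda>k\<in>{..<t}. y (i k))"
    unfolding mult_product_group by (rule restrict_ext) (use assms in auto)
  assume "x \<in> carrier (power_structure G p)"
  then show "(\<lambda>k\<in>{..<t}. x (i k)) \<in> carrier (power_structure G t)"
    unfolding carrier_product_group using assms
    by (intro restrict_PiE_iff[THEN iffD2] ballI) (auto simp: PiE_iff)
qed

lemma hom_of_coordinate:
  assumes "c \<in> hom G G" "1 \<le> p"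
  shows "(\<lambda>s. c (s 0)) \<in> hom (power_structure G p) G"
  using assms by (auto simp: hom_def PiE_iff Pi_iff)

context comm_group_pair
begin

text \<open>The difference of the composite with step \<open>h\<close> is the difference of
  \<open>f\<close> with step \<open>\<pi> h\<close>, composed with \<open>\<pi>\<close>; so the
  degree bound is inherited.\<close>

lemma polys_le_comp_hom:
  assumes H': "comm_group H'" and \<pi>: "\<pi> \<in> hom H' H" and f: "f \<in> P d"
  shows "(\<lambda>x. f (\<pi> x)) \<in> polys_le H' G d"
proof -
  interpret H': comm_group H' by fact
  interpret c: comm_group_pair G H'
    by unfold_locales
  have \<pi>c: "\<pi> x \<in> carrier H" if "x \<in> carrier H'" for x
    using \<pi> that by (auto simp: hom_def)
  have "c.deg_le d (\<lambda>x. f (\<pi> x))" if "deg_le d f"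
    using that
  proof (induction d arbitrary: f)
    case 0
    then show ?case using \<pi>c by auto
  next
    case (Suc d)
    have "c.deg_le d (\<lambda>x. f (\<pi> (x \<otimes>\<^bsub>H'\<^esub> h)) \<otimes> inv f (\<pi> x))" if h: "h \<in> carrier H'" for h
    proof -
      have "c.deg_le d (\<lambda>x. f (\<pi> x \<otimes>\<^bsub>H\<^esub> \<pi> h) \<otimes> inv f (\<pi> x))"
        using Suc.IH[of "\<lambda>x. f (x \<otimes>\<^bsub>H\<^esub> \<pi> h) \<otimes> inv f x"] Suc.prems \<pi>c[OF h] by simp
      then show ?thesis
        by (rule c.deg_le_eqI) (use h \<pi> in \<open>simp add: hom_mult\<close>)
    qed
    then show ?case by simp
  qed
  moreover have "\<pi> \<one>\<^bsub>H'\<^esub> = \<one>\<^bsub>H\<^esub>"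
    using hom_one[OF \<pi> H'.is_group H.is_group] .
  ultimately show ?thesis
    using f \<pi>c by (auto simp: polys_le_def)
qed

lemma P_decomposition:
  assumes "f \<in> P d" "h \<in> carrier H"
  shows "\<exists>q \<in> P d. \<forall>x \<in> carrier H. f (h \<otimes>\<^bsub>H\<^esub> x) = f h \<otimes> q x"
proof (intro bexI ballI)
  fix x assume x: "x \<in> carrier H"
  have c: "f h \<in> carrier G" "f (h \<otimes>\<^bsub>H\<^esub> x) \<in> carrier G"
    using x assms P_closed[OF assms(1)] by auto
  then have "f h \<otimes> shift H G h f x = f (h \<otimes>\<^bsub>H\<^esub> x) \<otimes> (f h \<otimes> inv f h)"
    by (simp only: shift_def G.m_ac G.inv_closed)
  then show "f (h \<otimes>\<^bsub>H\<^esub> x) = f h \<otimes> shift H G h f x"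
    using c by simp
qed (rule P_shift[OF assms])

end

lemma (in comm_semigroup) partition_regular_homs:
  assumes sh: "shape G m F c" and inf: "infinite (carrier G)"
    and c: "\<And>x. x \<in> carrier G \<Longrightarrow> c x = x"
    and F: "\<And>j. j \<in> {1..m} \<Longrightarrow> F j \<subseteq> hom (power_structure G j) G"
  shows "partition_regular G m F c"
proof (rule partition_regularI[OF sh, where \<F> = "\<lambda>p. hom (power_structure G p) G"])
  have "c ` carrier G = carrier G"
    using c by simp
  then show "infinite (c ` carrier G)"
    using inf by simp
  have "recurrent (power_structure G p) G (Pow (hom (power_structure G p) G)) (\<lambda>x. x) l" for p l
    using inf by (intro recurrent_hom comm_semigroup_power) auto
  then show "recurrent (power_structure G p) G (Pow (hom (power_structure G p) G)) c l" for p l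
    by (rule recurrent_cong[where c = "\<lambda>x. x", rotated]) (simp add: c)
  show "(\<lambda>s. c (s 0)) \<in> hom (power_structure G p) G" if "1 \<le> p" for p
    using sh that by (intro hom_of_coordinate) (auto simp: shape_def)
  show "(\<lambda>s. f (\<lambda>k\<in>{..<t}. s (i k))) \<in> hom (power_structure G p) G"
    if "t \<in> {1..m}" "f \<in> F t" "i \<in> {..<t} \<rightarrow> {..<p}" for p t f i
  proof -
    have "f \<in> hom (power_structure G t) G"
      using F that by blast
    from hom_compose[OF select_coordinates_hom[OF that(3)] this] show ?thesis
      by (simp only: comp_def)
  qed
  show "hom (power_structure G p) G \<subseteq> carrier (power_structure G p) \<rightarrow> carrier G" for p
    unfolding hom_def by blast
  show "\<exists>q \<in> hom (power_structure G p) G. \<forall>x \<in> carrier (power_structure G p).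
      f (h \<otimes>\<^bsub>power_structure G p\<^esub> x) = f h \<otimes> q x"
    if "f \<in> hom (power_structure G p) G" "h \<in> carrier (power_structure G p)" for p f h
    using that(1) by (intro bexI[of _ f] ballI hom_mult[OF that])
qed (use c in auto)

lemma (in comm_group) partition_regular_polys:
  assumes sh: "shape G m F c" and inf: "infinite (carrier G)"
    and fin: "finite (rcosets (c ` carrier G))"
    and F: "\<And>j. j \<in> {1..m} \<Longrightarrow> F j \<subseteq> poly_maps (power_structure G j) G"
  shows "partition_regular G m F c"
proof -
  have pair: "comm_group_pair G (power_structure G p)" for p
    using comm_group_power[of G p] comm_group_axioms unfolding comm_group_pair_def by blast
  have c: "c \<in> hom G G" and finF: "\<And>t. t \<in> {1..m} \<Longrightarrow> finite (F t)"
    using sh by (auto simp: shape_def)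
  interpret c: group_hom G G c
    by unfold_locales (rule c)
  have "\<exists>d. f \<in> polys_le (power_structure G t) G d" if "t \<in> {1..m}" "f \<in> F t" for t f
    using F[OF that(1)] comm_group_pair.poly_maps_subset[OF pair, of t] that(2) by blast
  then obtain \<delta> where \<delta>: "\<And>t f. \<lbrakk>t \<in> {1..m}; f \<in> F t\<rbrakk> \<Longrightarrow> f \<in> polys_le (power_structure G t) G (\<delta> t f)"
    by metis
  \<comment> \<open>\<open>Suc\<close> makes the degree positive, so that the homomorphism
    \<open>s \<mapsto> c (s 0)\<close> is included; \<open>insert 0\<close> keeps \<open>Max\<close>
    meaningful if all \<open>F t\<close> are empty.\<close>
  define d where "d = Suc (Max (insert 0 (\<Union>t \<in> {1..m}. \<delta> t ` F t)))"
  have Fd: "f \<in> polys_le (power_structure G t) G d" if "t \<in> {1..m}" "f \<in> F t" for t f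
  proof -
    have "\<delta> t f \<le> Max (insert 0 (\<Union>t \<in> {1..m}. \<delta> t ` F t))"
      using that finF by (intro Max_ge) auto
    then have "\<delta> t f \<le> d"
      by (simp add: d_def)
    then show ?thesis
      using comm_group_pair.P_mono[OF pair] \<delta>[OF that] by blast
  qed
  show ?thesis
  proof (rule comm_semigroup.partition_regularI[OF comm_semigroup sh,
        where \<F> = "\<lambda>p. polys_le (power_structure G p) G d"])
    \<comment> \<open>With a finite image, \<open>G\<close> would be a union of finitely many finite
      cosets.\<close>
    show "infinite (c ` carrier G)"
    proof
      assume f: "finite (c ` carrier G)"
      have "finite X" if X: "X \<in> rcosets (c ` carrier G)" for X
      proof -
        obtain a where "X = (\<lambda>h. h \<otimes> a) ` c ` carrier G"
          using X by (auto simp: RCOSETS_def r_coset_def)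
        then show ?thesis
          using f by simp
      qed
      then have "finite (\<Union>(rcosets (c ` carrier G)))"
        using fin by blast
      then show False
        using inf rcosets_part_G[OF c.img_is_subgroup] by simp
    qed
    show "x \<in> nonidentity G" if "x \<in> carrier G" "c x \<in> nonidentity G" for x
    proof (rule ccontr)
      assume "x \<notin> nonidentity G"
      then have "x \<otimes> \<one> = \<one>"
        using that(1) unfolding nonidentity_def by blast
      then have "c x = \<one>"
        using that(1) by simp
      then show False
        using that(2) by (simp add: nonidentity_def)
    qed
    show "recurrent (power_structure G p) G (Pow (polys_le (power_structure G p) G d)) c l" for p l
      by (rule recurrent_finite_index[OF c fin
            comm_semigroup.comm_semigroup_power[OF comm_semigroup]
            comm_group_pair.recurrent_polys[OF pair]])
    show "polys_le (power_structure G p) G d \<subseteq> carrier (power_structure G p) \<rightarrow> carrier G" for p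
      unfolding polys_le_def by blast
    show "\<exists>q \<in> polys_le (power_structure G p) G d. \<forall>x \<in> carrier (power_structure G p).
        f (h \<otimes>\<^bsub>power_structure G p\<^esub> x) = f h \<otimes> q x"
      if "f \<in> polys_le (power_structure G p) G d" "h \<in> carrier (power_structure G p)" for p f h
      by (rule comm_group_pair.P_decomposition[OF pair that])
    show "(\<lambda>s. c (s 0)) \<in> polys_le (power_structure G p) G d" if "1 \<le> p" for p
      unfolding d_def by (rule comm_group_pair.P_hom[OF pair hom_of_coordinate[OF c that]])
    show "(\<lambda>s. f (\<lambda>k\<in>{..<t}. s (i k))) \<in> polys_le (power_structure G p) G d"
      if "t \<in> {1..m}" "f \<in> F t" "i \<in> {..<t} \<rightarrow> {..<p}" for p t f i
      by (rule comm_group_pair.polys_le_comp_hom[OF pair comm_group_power select_coordinates_hom Fd])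
         (use that comm_group_axioms in auto)
  qed
qed

theorem corollary3p7:
  fixes G :: "('a, 'b) monoid_scheme"
    and m :: nat
    and F :: "nat \<Rightarrow> ((nat \<Rightarrow> 'a) \<Rightarrow> 'a) set"
    and c :: "'a \<Rightarrow> 'a"
  assumes "comm_semigroup G"
    and "countable (carrier G)"
    and "infinite (carrier G)"
    and "shape G m F c"
    and "((\<forall>x \<in> carrier G. c x = x) \<and>
           (\<forall>j \<in> {1..m}. F j \<subseteq> hom (power_structure G j) G)) \<or>
         (group G \<and> finite (rcosets\<^bsub>G\<^esub> (c ` carrier G)) \<and>
           (\<forall>j \<in> {1..m}. F j \<subseteq> poly_maps (power_structure G j) G))"
  shows "partition_regular G m F c"
  using assms(5)
proof (elim disjE conjE)
  assume "\<forall>x \<in> carrier G. c x = x" "\<forall>j \<in> {1..m}. F j \<subseteq> hom (power_structure G j) G"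
  then show ?thesis
    using comm_semigroup.partition_regular_homs[OF assms(1,4,3)] by blast
next
  assume "group G" and fin: "finite (rcosets\<^bsub>G\<^esub> (c ` carrier G))"
    and F: "\<forall>j \<in> {1..m}. F j \<subseteq> poly_maps (power_structure G j) G"
  have "comm_group G"
    by (rule group.group_comm_groupI[OF \<open>group G\<close>]) (rule comm_semigroup.m_comm[OF assms(1)])
  then show ?thesis
    using comm_group.partition_regular_polys[OF _ assms(4,3) fin] F by blast
qed

end
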